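(* Let $\Omega\subset\mathbb{R}^N$ ($N\ge1$) be a bounded Lipschitz domain, $\mu_1,\mu_2>0$, $\beta\in\mathbb{R}$, and $1+4/N<p\le 2^*-1$ (no upper bound if $N=1,2$; $2^*-1=(N+2)/(N-2)$ if $N\ge3$). Then the set $A$ is star-shaped with respect to $(0,0)$. Moreover, there exists a positive constant $R=R(\Omega,N,p)$ such that if $\rho_1,\rho_2\ge0$ satisfy $$\Big[\max\{\mu_1\rho_1^{2r},\mu_2\rho_2^{2r}\}+\beta^+\rho_1^r\rho_2^r\Big](\rho_1+\rho_2)^{a-1}\le R(\Omega,N,p),$$ then $(\rho_1,\rho_2)\in A$.
   Context: $\beta^+=\max\{\beta,0\}$; $a=N(p-1)/4$, $r=\frac{p+1}{4}-\frac{N(p-1)}{8}$. $\lambda_1(\Omega)$ is the first Dirichlet eigenvalue of $-\Delta$ in $\Omega$. For $(u_1,u_2)\in H^1_0(\Omega;\mathbb{R}^2)$, $\mathcal{E}(u_1,u_2)=\frac12\int_\Omega(|\nabla u_1|^2+|\nabla u_2|^2)-\frac{1}{p+1}\int_\Omega(\mu_1|u_1|^{p+1}+2\beta|u_1|^{(p+1)/2}|u_2|^{(p+1)/2}+\mu_2|u_2|^{p+1})$. For $\rho_1,\rho_2\ge0$ and $\alpha\ge\lambda_1(\Omega)$: $\mathcal{M}=\{(u_1,u_2)\in H^1_0(\Omega;\mathbb{R}^2):\int_\Omega u_i^2=\rho_i\}$, $\mathcal{B}_\alpha=\{(u_1,u_2)\in\mathcal{M}:\int_\Omega|\nabla u_1|^2+|\nabla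 u_2|^2\le(\rho_1+\rho_2)\alpha\}$, $\mathcal{U}_\alpha=\{(u_1,u_2)\in\mathcal{M}:\int_\Omega|\nabla u_1|^2+|\nabla u_2|^2=(\rho_1+\rho_2)\alpha\}$, $c_\alpha=\inf_{\mathcal{B}_\alpha}\mathcal{E}$, $\hat c_\alpha=\inf_{\mathcal{U}_\alpha}\mathcal{E}$ (all depending on $(\rho_1,\rho_2)$). For $N\ge3$, $2^*=2N/(N-2)$, $S_N$ is the smallest constant with $\|v\|_{L^{2^*}(\mathbb{R}^N)}^{2^*}\le S_N\|\nabla v\|_{L^2(\mathbb{R}^N)}^{2^*}$ on $\mathcal{D}^{1,2}(\mathbb{R}^N)$, and $\Lambda=\frac{2S_N}{2^*}\max_{x^2+y^2=1}(\mu_1|x|^{2^*}+\mu_2|y|^{2^*}+2\beta^+|xy|^{2^*/2})$. The set of admissible masses is $A=\{(\rho_1,\rho_2)\in[0,\infty)^2:\ c_\alpha<\hat c_\alpha$ for some $\alpha\ge\lambda_1(\Omega)$, where in case $N\ge3$, $p=2^*-1$ $\alpha$ must also satisfy $(\rho_1+\rho_2)(\alpha-\lambda_1(\Omega))\le\Lambda^{-(N-2)/2}\}\cup\{(0,0)\}$. *)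

theory Defs
  imports "HOL-Analysis.Analysis"
begin

text \<open>A domain (nonempty open connected set) whose boundary is, near every boundary point,
  the strict epigraph of a Lipschitz function in a suitable orthonormal frame: direction e
  (unit vector) and a Lipschitz graph function h depending only on the component
  orthogonal to e.\<close>
definition lipschitz_domain :: "'a::euclidean_space set \<Rightarrow> bool" where
  "lipschitz_domain \<Omega> \<longleftrightarrow> open \<Omega> \<and> connected \<Omega> \<and> \<Omega> \<noteq> {} \<and>
    (\<forall>x0\<in>frontier \<Omega>. \<exists>r>0. \<exists>e (h::'a \<Rightarrow> real) L.
        norm e = 1 \<and> L-lipschitz_on UNIV h \<and>
        (\<forall>x. h x = h (x - (x \<bullet> e) *\<^sub>R e)) \<and>
        \<Omega> \<inter> ball x0 r = {x \<in> ball x0 r. h x < x \<bullet> e})"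

definition C1c :: "'a::euclidean_space set \<Rightarrow> ('a \<Rightarrow> real) \<Rightarrow> ('a \<Rightarrow> 'a) \<Rightarrow> bool" where
  "C1c U phi dphi \<longleftrightarrow>
     (\<forall>x. (phi has_derivative (\<lambda>h. dphi x \<bullet> h)) (at x)) \<and> continuous_on UNIV dphi \<and>
     (\<exists>K. compact K \<and> K \<subseteq> U \<and> (\<forall>x. x \<notin> K \<longrightarrow> phi x = 0))"

text \<open>H^1_0(Omega): pairs (u, g) (function and weak gradient) that are H^1-limits of
  C^1 functions compactly supported in Omega (functions are extended by zero outside Omega).\<close>
definition H10 :: "'a::euclidean_space set \<Rightarrow> (('a \<Rightarrow> real) \<times> ('a \<Rightarrow> 'a)) set" where
  "H10 \<Omega> = {(u, g). u \<in> borel_measurable lborel \<and> g \<in> borel_measurable lborel \<and>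
     (\<exists>phi dphi. (\<forall>k. C1c \<Omega> (phi k) (dphi k)) \<and>
        (\<lambda>k. \<integral>\<^sup>+ x. ennreal ((phi k x - u x)\<^sup>2) \<partial>lborel) \<longlonglongrightarrow> 0 \<and>
        (\<lambda>k. \<integral>\<^sup>+ x. ennreal ((norm (dphi k x - g x))\<^sup>2) \<partial>lborel) \<longlonglongrightarrow> 0)}"

text \<open>Critical Sobolev exponent 2^* = 2N/(N-2) (used only for N >= 3).\<close>
definition two_star :: "nat \<Rightarrow> real" where
  "two_star N = 2 * real N / (real N - 2)"

text \<open>D^{1,2}(R^N): completion of C^1_c(R^N), realised as pairs (v, g) with
  phi_k -> v in L^{2^*} and grad phi_k -> g in L^2.\<close>
definition D12 :: "(('a::euclidean_space \<Rightarrow> real) \<times> ('a \<Rightarrow> 'a)) set" where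
  "D12 = {(v, g). v \<in> borel_measurable lborel \<and> g \<in> borel_measurable lborel \<and>
     (\<exists>phi dphi. (\<forall>k. C1c UNIV (phi k) (dphi k)) \<and>
        (\<lambda>k. \<integral>\<^sup>+ x. ennreal (\<bar>phi k x - v x\<bar> powr two_star DIM('a)) \<partial>lborel) \<longlonglongrightarrow> 0 \<and>
        (\<lambda>k. \<integral>\<^sup>+ x. ennreal ((norm (dphi k x - g x))\<^sup>2) \<partial>lborel) \<longlonglongrightarrow> 0)}"

definition sobolev_const :: "'a::euclidean_space itself \<Rightarrow> real" where
  "sobolev_const _ = Inf {S. \<forall>(v, g) \<in> (D12 :: (('a \<Rightarrow> real) \<times> ('a \<Rightarrow> 'a)) set).
      (\<integral>x. \<bar>v x\<bar> powr two_star DIM('a) \<partial>lborel)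
        \<le> S * (\<integral>x. (norm (g x))\<^sup>2 \<partial>lborel) powr (two_star DIM('a) / 2)}"

text \<open>First Dirichlet eigenvalue of -Delta in Omega (Rayleigh quotient infimum).\<close>
definition lambda1 :: "'a::euclidean_space set \<Rightarrow> real" where
  "lambda1 \<Omega> = Inf {(\<integral>x. (norm (g x))\<^sup>2 \<partial>lborel) / (\<integral>x. (u x)\<^sup>2 \<partial>lborel) | u g.
      (u, g) \<in> H10 \<Omega> \<and> (\<integral>x. (u x)\<^sup>2 \<partial>lborel) \<noteq> 0}"

type_synonym 'a pairH = "(('a \<Rightarrow> real) \<times> ('a \<Rightarrow> 'a)) \<times> (('a \<Rightarrow> real) \<times> ('a \<Rightarrow> 'a))"

definition energy :: "real \<Rightarrow> real \<Rightarrow> real \<Rightarrow> real \<Rightarrow> 'a::euclidean_space pairH \<Rightarrow> real" where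
  "energy \<mu>1 \<mu>2 \<beta> p U = (case U of ((u1, g1), (u2, g2)) \<Rightarrow>
     1/2 * (\<integral>x. (norm (g1 x))\<^sup>2 + (norm (g2 x))\<^sup>2 \<partial>lborel)
     - 1/(p+1) * (\<integral>x. \<mu>1 * \<bar>u1 x\<bar> powr (p+1)
          + 2 * \<beta> * \<bar>u1 x\<bar> powr ((p+1)/2) * \<bar>u2 x\<bar> powr ((p+1)/2)
          + \<mu>2 * \<bar>u2 x\<bar> powr (p+1) \<partial>lborel))"

definition grad_sq :: "'a::euclidean_space pairH \<Rightarrow> real" where
  "grad_sq U = (case U of ((u1, g1), (u2, g2)) \<Rightarrow>
     (\<integral>x. (norm (g1 x))\<^sup>2 + (norm (g2 x))\<^sup>2 \<partial>lborel))"

definition mass_set :: "'a::euclidean_space set \<Rightarrow> real \<Rightarrow> real \<Rightarrow> 'a pairH set" where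
  "mass_set \<Omega> \<rho>1 \<rho>2 = {((u1, g1), (u2, g2)). (u1, g1) \<in> H10 \<Omega> \<and> (u2, g2) \<in> H10 \<Omega> \<and>
      (\<integral>x. (u1 x)\<^sup>2 \<partial>lborel) = \<rho>1 \<and> (\<integral>x. (u2 x)\<^sup>2 \<partial>lborel) = \<rho>2}"

definition B_set :: "'a::euclidean_space set \<Rightarrow> real \<Rightarrow> real \<Rightarrow> real \<Rightarrow> 'a pairH set" where
  "B_set \<Omega> \<rho>1 \<rho>2 \<alpha> = {U \<in> mass_set \<Omega> \<rho>1 \<rho>2. grad_sq U \<le> (\<rho>1 + \<rho>2) * \<alpha>}"

definition U_set :: "'a::euclidean_space set \<Rightarrow> real \<Rightarrow> real \<Rightarrow> real \<Rightarrow> 'a pairH set" where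
  "U_set \<Omega> \<rho>1 \<rho>2 \<alpha> = {U \<in> mass_set \<Omega> \<rho>1 \<rho>2. grad_sq U = (\<rho>1 + \<rho>2) * \<alpha>}"

text \<open>Infima taken in the extended reals (inf of the empty set is +infinity).\<close>
definition c_alpha :: "'a::euclidean_space set \<Rightarrow> real \<Rightarrow> real \<Rightarrow> real \<Rightarrow> real \<Rightarrow> real \<Rightarrow> real \<Rightarrow> real \<Rightarrow> ereal" where
  "c_alpha \<Omega> \<mu>1 \<mu>2 \<beta> p \<rho>1 \<rho>2 \<alpha> = (INF U \<in> B_set \<Omega> \<rho>1 \<rho>2 \<alpha>. ereal (energy \<mu>1 \<mu>2 \<beta> p U))"

definition c_hat_alpha :: "'a::euclidean_space set \<Rightarrow> real \<Rightarrow> real \<Rightarrow> real \<Rightarrow> real \<Rightarrow> real \<Rightarrow> real \<Rightarrow> real \<Rightarrow> ereal" where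
  "c_hat_alpha \<Omega> \<mu>1 \<mu>2 \<beta> p \<rho>1 \<rho>2 \<alpha> = (INF U \<in> U_set \<Omega> \<rho>1 \<rho>2 \<alpha>. ereal (energy \<mu>1 \<mu>2 \<beta> p U))"

definition Lambda_const :: "'a::euclidean_space itself \<Rightarrow> real \<Rightarrow> real \<Rightarrow> real \<Rightarrow> real" where
  "Lambda_const T \<mu>1 \<mu>2 \<beta> = 2 * sobolev_const T / two_star DIM('a) *
     Sup ((\<lambda>(x, y). \<mu>1 * \<bar>x\<bar> powr two_star DIM('a) + \<mu>2 * \<bar>y\<bar> powr two_star DIM('a)
            + 2 * max \<beta> 0 * \<bar>x * y\<bar> powr (two_star DIM('a) / 2)) ` {(x, y). x\<^sup>2 + y\<^sup>2 = 1})"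

definition critical :: "'a::euclidean_space itself \<Rightarrow> real \<Rightarrow> bool" where
  "critical _ p \<longleftrightarrow> DIM('a) \<ge> 3 \<and> p = two_star DIM('a) - 1"

definition admissible :: "'a::euclidean_space set \<Rightarrow> real \<Rightarrow> real \<Rightarrow> real \<Rightarrow> real \<Rightarrow> (real \<times> real) set" where
  "admissible \<Omega> \<mu>1 \<mu>2 \<beta> p =
     {(\<rho>1, \<rho>2). \<rho>1 \<ge> 0 \<and> \<rho>2 \<ge> 0 \<and>
        (\<exists>\<alpha> \<ge> lambda1 \<Omega>. c_alpha \<Omega> \<mu>1 \<mu>2 \<beta> p \<rho>1 \<rho>2 \<alpha> < c_hat_alpha \<Omega> \<mu>1 \<mu>2 \<beta> p \<rho>1 \<rho>2 \<alpha> \<and>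
          (critical TYPE('a) p \<longrightarrow>
             (\<rho>1 + \<rho>2) * (\<alpha> - lambda1 \<Omega>) \<le>
               Lambda_const TYPE('a) \<mu>1 \<mu>2 \<beta> powr (- (real DIM('a) - 2) / 2)))}
     \<union> {(0, 0)}"

definition exp_a :: "nat \<Rightarrow> real \<Rightarrow> real" where
  "exp_a N p = real N * (p - 1) / 4"

definition exp_r :: "nat \<Rightarrow> real \<Rightarrow> real" where
  "exp_r N p = (p + 1) / 4 - real N * (p - 1) / 8"

text \<open>Real power of a nonnegative base with the convention x^0 = 1 (also for x = 0),
  needed since r = 0 in the critical case.\<close>
definition pow0 :: "real \<Rightarrow> real \<Rightarrow> real" where
  "pow0 x e = (if e = 0 then 1 else x powr e)"

end

theory Submission
  imports Defs
begin

text \<open>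
  Star-shapedness: under \<open>u \<mapsto> \<surd>t u\<close> the gradient term is multiplied by \<open>t\<close> and the nonlinear
  term by the smaller factor \<open>t s\<close>, \<open>s = t powr ((p - 1) / 2) \<le> 1\<close>. Hence for the same \<open>\<alpha>\<close> the
  energy gap between \<open>V \<in> U\<^sub>\<alpha>\<close> and \<open>U \<in> B\<^sub>\<alpha>\<close> becomes \<open>t\<close> times a convex combination of the old
  gap and half the difference of the gradient terms, which is nonnegative.

  Small masses: two normalised bumps with disjoint supports, scaled to the masses \<open>\<rho>\<^sub>1, \<rho>\<^sub>2\<close>, are
  not affected by the sign of \<open>\<beta>\<close> and have energy at most \<open>(\<rho>\<^sub>1 + \<rho>\<^sub>2) \<kappa> / 2\<close>, where \<open>\<kappa>\<close> bounds their
  Rayleigh quotients. For \<open>\<alpha> = \<kappa> + 2\<close> the Gagliardo-Nirenberg inequality makes the nonlinear term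
  on \<open>U\<^sub>\<alpha>\<close> so small that the energy there is at least \<open>(\<rho>\<^sub>1 + \<rho>\<^sub>2) (\<kappa> + 1) / 2\<close>.

  Gagliardo-Nirenberg with exponent \<open>q\<close> in dimension \<open>n \<ge> 2\<close> follows by applying the \<open>L\<^sup>1\<close> Sobolev
  inequality to \<open>|u| powr s\<close> with \<open>s = q (n - 1) / n\<close>, interpolating \<open>\<integral> |u| powr (2 s - 2)\<close> between the
  exponents \<open>2\<close> and \<open>q\<close>, and absorbing the resulting power of \<open>\<integral> |u| powr q\<close>.
\<close>

section \<open>Hoelder's inequality for nonnegative integrals\<close>

text \<open>Convention: \<open>x\<^sup>0 = 1\<close> also for \<open>x = 0\<close> and \<open>x = \<infinity>\<close>, in accordance with \<^const>\<open>pow0\<close>.\<close>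

definition epowr :: "ennreal \<Rightarrow> real \<Rightarrow> ennreal" where
  "epowr x q = (if q = 0 then 1 else if x = top then top else ennreal (enn2real x powr q))"

lemma pow0_nonneg [simp]: "0 \<le> pow0 x q"
  by (simp add: pow0_def)

lemma epowr_zero_right [simp]: "epowr x 0 = 1"
  by (simp add: epowr_def)

lemma epowr_ennreal: "0 \<le> x \<Longrightarrow> epowr (ennreal x) q = ennreal (pow0 x q)"
  by (simp add: epowr_def pow0_def)

lemma epowr_zero_left [simp]: "q \<noteq> 0 \<Longrightarrow> epowr 0 q = 0"
  by (simp add: epowr_def)

lemma epowr_top [simp]: "q \<noteq> 0 \<Longrightarrow> epowr top q = top"
  by (simp add: epowr_def)

lemma epowr_one_right [simp]: "epowr x 1 = x"
  by (cases x) (simp_all add: epowr_ennreal pow0_def)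

lemma epowr_eq_0_iff: "epowr x q = 0 \<longleftrightarrow> q \<noteq> 0 \<and> x = 0"
  by (cases x) (auto simp: epowr_def)

lemma epowr_eq_top_iff: "epowr x q = top \<longleftrightarrow> q \<noteq> 0 \<and> x = top"
  by (auto simp: epowr_def)

lemma measurable_epowr [measurable]:
  assumes [measurable]: "f \<in> borel_measurable M"
  shows "(\<lambda>x. epowr (f x) q) \<in> borel_measurable M"
  unfolding epowr_def by measurable

lemma epowr_mono: "x \<le> y \<Longrightarrow> 0 \<le> q \<Longrightarrow> epowr x q \<le> epowr y q"
  by (cases x; cases y) (auto simp: epowr_def powr_mono2 top_unique)

lemma epowr_add: "0 \<le> q \<Longrightarrow> 0 \<le> q' \<Longrightarrow> epowr x (q + q') = epowr x q * epowr x q'"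
  by (cases x) (auto simp: epowr_def powr_add ennreal_mult ennreal_mult_top ennreal_top_mult)

lemma epowr_mult: "0 \<le> q \<Longrightarrow> epowr (x * y) q = epowr x q * epowr y q"
proof (cases x; cases y)
  fix a b :: real assume "x = ennreal a" "0 \<le> a" "y = ennreal b" "0 \<le> b"
  then show ?thesis
    by (simp add: ennreal_mult[symmetric] epowr_ennreal) (simp add: pow0_def powr_mult)
qed (auto simp: epowr_def ennreal_mult_top ennreal_top_mult)

lemma epowr_epowr: "0 \<le> a \<Longrightarrow> 0 \<le> b \<Longrightarrow> epowr (epowr x a) b = epowr x (a * b)"
  by (cases x) (auto simp: epowr_def powr_powr)

section \<open>Weighted means and Hoelder's inequality for finitely many factors\<close>

text \<open>Jensen's inequality for \<open>exp\<close> at the points \<open>ln (x j)\<close>. If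
  some \<open>x j\<close> is 0, the logarithm is of no use, but then the product is 0.\<close>

lemma weighted_AM_GM:
  fixes x w :: "'i \<Rightarrow> real"
  assumes "finite J" "\<And>j. j \<in> J \<Longrightarrow> 0 < w j" "(\<Sum>j\<in>J. w j) = 1" "\<And>j. j \<in> J \<Longrightarrow> 0 \<le> x j"
  shows "(\<Prod>j\<in>J. x j powr w j) \<le> (\<Sum>j\<in>J. w j * x j)"
proof (cases "\<exists>j\<in>J. x j = 0")
  case True
  then have "(\<Prod>j\<in>J. x j powr w j) = 0"
    using assms(1) by (auto intro!: prod_zero)
  moreover have "0 \<le> (\<Sum>j\<in>J. w j * x j)"
    using assms by (intro sum_nonneg mult_nonneg_nonneg) (auto intro: less_imp_le)
  ultimately show ?thesis by simp
next
  case False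
  then have pos: "\<And>j. j \<in> J \<Longrightarrow> 0 < x j" using assms(4) by (force simp: less_le)
  have "J \<noteq> {}" using assms(3) by auto
  have "exp (\<Sum>j\<in>J. w j *\<^sub>R ln (x j)) \<le> (\<Sum>j\<in>J. w j * exp (ln (x j)))"
    using assms by (intro convex_on_sum[OF _ \<open>J \<noteq> {}\<close> exp_convex]) (auto intro: less_imp_le)
  moreover have "exp (\<Sum>j\<in>J. w j *\<^sub>R ln (x j)) = (\<Prod>j\<in>J. x j powr w j)"
    using pos by (simp add: exp_sum[OF assms(1)] powr_def less_imp_neq[symmetric])
  moreover have "(\<Sum>j\<in>J. w j * exp (ln (x j))) = (\<Sum>j\<in>J. w j * x j)"
    using pos by simp
  ultimately show ?thesis by simp
qed

text \<open>An infinite \<open>x j\<close> makes the right-hand side infinite because its weight is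
  positive; otherwise all values are real and the inequality for reals applies.\<close>

lemma weighted_AM_GM_ennreal:
  fixes x :: "'i \<Rightarrow> ennreal" and w :: "'i \<Rightarrow> real"
  assumes "finite J" "\<And>j. j \<in> J \<Longrightarrow> 0 < w j" "(\<Sum>j\<in>J. w j) = 1"
  shows "(\<Prod>j\<in>J. epowr (x j) (w j)) \<le> (\<Sum>j\<in>J. ennreal (w j) * x j)"
proof (cases "\<exists>j\<in>J. x j = top")
  case True
  then obtain j where "j \<in> J" "x j = top" by blast
  then have "(\<Sum>j\<in>J. ennreal (w j) * x j) = top"
    using assms(1) assms(2)[of j] by (subst ennreal_sum_eq_top) (auto simp: ennreal_mult_top intro!: bexI[of _ j])
  then show ?thesis by simp
next
  case False
  define y where "y j = enn2real (x j)" for j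
  have y: "x j = ennreal (y j)" "0 \<le> y j" if "j \<in> J" for j
    using False that by (auto simp: y_def less_top)
  have "(\<Prod>j\<in>J. epowr (x j) (w j)) = (\<Prod>j\<in>J. ennreal (y j powr w j))"
    using y assms(2) by (intro prod.cong refl) (simp add: epowr_ennreal pow0_def less_imp_neq[symmetric])
  also have "\<dots> = ennreal (\<Prod>j\<in>J. y j powr w j)"
    by (simp add: prod_ennreal)
  also have "\<dots> \<le> ennreal (\<Sum>j\<in>J. w j * y j)"
    using assms y(2) by (intro ennreal_leI weighted_AM_GM) auto
  also have "\<dots> = (\<Sum>j\<in>J. ennreal (w j * y j))"
    using assms y by (intro sum_ennreal[symmetric] mult_nonneg_nonneg) (auto intro: less_imp_le)
  also have "\<dots> = (\<Sum>j\<in>J. ennreal (w j) * x j)"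
    using assms y by (intro sum.cong) (auto simp: ennreal_mult less_imp_le)
  finally show ?thesis .
qed

text \<open>Dividing each \<open>f j\<close> by its integral normalises all integrals to 1. The
  pointwise weighted AM-GM inequality then integrates to the sum of the weights, which is 1.\<close>

lemma Hoelder_nn_integral_pos:
  fixes f :: "'i \<Rightarrow> 'b \<Rightarrow> ennreal" and w :: "'i \<Rightarrow> real"
  assumes J: "finite J" "\<And>j. j \<in> J \<Longrightarrow> 0 < w j" "(\<Sum>j\<in>J. w j) = 1"
    and [measurable]: "\<And>j. j \<in> J \<Longrightarrow> f j \<in> borel_measurable M"
  shows "(\<integral>\<^sup>+x. (\<Prod>j\<in>J. epowr (f j x) (w j)) \<partial>M) \<le> (\<Prod>j\<in>J. epowr (\<integral>\<^sup>+x. f j x \<partial>M) (w j))"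
proof -
  define A where "A j = (\<integral>\<^sup>+x. f j x \<partial>M)" for j
  \<comment> \<open>Vanishing integrals come first: in the case \<open>top\<close> no factor may be
    0, since \<open>0 * top = 0\<close> would spoil the infinite right-hand side.\<close>
  consider (zero) j where "j \<in> J" "A j = 0" | (top) j where "j \<in> J" "A j = top" "\<And>i. i \<in> J \<Longrightarrow> A i \<noteq> 0"
    | (fin) "\<And>i. i \<in> J \<Longrightarrow> A i \<noteq> 0 \<and> A i \<noteq> top" by metis
  then show ?thesis
  proof cases
    case zero
    then have "AE x in M. f j x = 0"
      by (subst nn_integral_0_iff_AE[symmetric]) (auto simp: A_def)
    then have "AE x in M. (\<Prod>j\<in>J. epowr (f j x) (w j)) = 0"
    proof eventually_elim
      case (elim x)
      with zero J(1) J(2)[OF zero(1)] show ?case by (intro prod_zero) (auto intro!: bexI[of _ j])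
    qed
    then have "(\<integral>\<^sup>+x. (\<Prod>j\<in>J. epowr (f j x) (w j)) \<partial>M) = (\<integral>\<^sup>+x. 0 \<partial>M)"
      by (intro nn_integral_cong_AE)
    then show ?thesis by simp
  next
    case top
    have "(\<Prod>j\<in>J. epowr (A j) (w j)) = epowr (A j) (w j) * (\<Prod>j\<in>J - {j}. epowr (A j) (w j))"
      using top J(1) by (simp add: prod.remove)
    also have "\<dots> = top"
      using top J(1) J(2)[OF top(1)] by (auto simp: ennreal_top_mult epowr_eq_0_iff)
    finally show ?thesis by (simp add: A_def)
  next
    case fin
    define P where "P = (\<Prod>j\<in>J. epowr (A j) (w j))"
    have "(\<integral>\<^sup>+x. (\<Prod>j\<in>J. epowr (f j x) (w j)) \<partial>M)
        = (\<integral>\<^sup>+x. P * (\<Prod>j\<in>J. epowr (f j x / A j) (w j)) \<partial>M)"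
    proof (intro nn_integral_cong)
      fix x
      have "epowr (f j x) (w j) = epowr (A j) (w j) * epowr (f j x / A j) (w j)" if "j \<in> J" for j
        using fin[OF that] J(2)[OF that] ennreal_mult_divide_eq[of "A j" "f j x"]
        by (subst epowr_mult[symmetric]) (auto simp: mult.commute ennreal_times_divide)
      then show "(\<Prod>j\<in>J. epowr (f j x) (w j)) = P * (\<Prod>j\<in>J. epowr (f j x / A j) (w j))"
        by (simp add: P_def prod.distrib[symmetric])
    qed
    also have "\<dots> \<le> (\<integral>\<^sup>+x. P * (\<Sum>j\<in>J. ennreal (w j) * (f j x / A j)) \<partial>M)"
      using J by (intro nn_integral_mono mult_left_mono weighted_AM_GM_ennreal) auto
    also have "\<dots> = P * (\<Sum>j\<in>J. ennreal (w j) * (A j / A j))"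
      by (simp add: nn_integral_cmult nn_integral_sum nn_integral_divide A_def)
    also have "(\<Sum>j\<in>J. ennreal (w j) * (A j / A j)) = (\<Sum>j\<in>J. ennreal (w j))"
      using fin by (intro sum.cong refl) (simp add: ennreal_divide_self less_top)
    also have "\<dots> = 1"
      using J by (subst sum_ennreal) (auto intro: less_imp_le)
    finally show ?thesis by (simp add: P_def A_def)
  qed
qed

lemma Hoelder_nn_integral:
  fixes f :: "'i \<Rightarrow> 'b \<Rightarrow> ennreal" and w :: "'i \<Rightarrow> real"
  assumes J: "finite J" "\<And>j. j \<in> J \<Longrightarrow> 0 \<le> w j" "(\<Sum>j\<in>J. w j) = 1"
    and meas: "\<And>j. j \<in> J \<Longrightarrow> f j \<in> borel_measurable M"
  shows "(\<integral>\<^sup>+x. (\<Prod>j\<in>J. epowr (f j x) (w j)) \<partial>M) \<le> (\<Prod>j\<in>J. epowr (\<integral>\<^sup>+x. f j x \<partial>M) (w j))"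
proof -
  let ?K = "{j\<in>J. w j \<noteq> 0}"
  have *: "(\<Prod>j\<in>J. epowr (g j) (w j)) = (\<Prod>j\<in>?K. epowr (g j) (w j))" for g
    using J(1) by (intro prod.mono_neutral_right) auto
  have "(\<Sum>j\<in>J. w j) = (\<Sum>j\<in>?K. w j)"
    using J(1) by (intro sum.mono_neutral_right) auto
  then show ?thesis
    unfolding * using J meas by (intro Hoelder_nn_integral_pos) (auto simp: less_eq_real_def)
qed

text \<open>One factor \<open>g\<close> with its own weight \<open>v\<close> is split off, with
  \<open>None\<close> as its index. Both the induction over coordinates and the interpolation in the
  Gagliardo-Nirenberg inequality use this form.\<close>

lemma Hoelder_nn_integral_insert:
  fixes f :: "'i \<Rightarrow> 'b \<Rightarrow> ennreal" and w :: "'i \<Rightarrow> real"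
  assumes J: "finite J" "\<And>j. j \<in> J \<Longrightarrow> 0 \<le> w j" "0 \<le> v" "v + (\<Sum>j\<in>J. w j) = 1"
    and meas: "\<And>j. j \<in> J \<Longrightarrow> f j \<in> borel_measurable M" "g \<in> borel_measurable M"
  shows "(\<integral>\<^sup>+x. epowr (g x) v * (\<Prod>j\<in>J. epowr (f j x) (w j)) \<partial>M)
    \<le> epowr (\<integral>\<^sup>+x. g x \<partial>M) v * (\<Prod>j\<in>J. epowr (\<integral>\<^sup>+x. f j x \<partial>M) (w j))"
proof -
  let ?K = "insert None (Some ` J)"
  have "(\<integral>\<^sup>+x. (\<Prod>k\<in>?K. epowr (case_option g f k x) (case_option v w k)) \<partial>M)
      \<le> (\<Prod>k\<in>?K. epowr (\<integral>\<^sup>+x. case_option g f k x \<partial>M) (case_option v w k))"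
    using J meas by (intro Hoelder_nn_integral) (auto simp: sum.reindex)
  then show ?thesis
    using J(1) by (simp add: prod.reindex)
qed

lemma Hoelder2_nn_integral:
  fixes f g :: "'b \<Rightarrow> ennreal"
  assumes "0 \<le> v" "0 \<le> w" "v + w = 1" "f \<in> borel_measurable M" "g \<in> borel_measurable M"
  shows "(\<integral>\<^sup>+x. epowr (f x) v * epowr (g x) w \<partial>M)
    \<le> epowr (\<integral>\<^sup>+x. f x \<partial>M) v * epowr (\<integral>\<^sup>+x. g x \<partial>M) w"
  using Hoelder_nn_integral_insert[of "{()}" "\<lambda>_. w" v "\<lambda>_. g" M f] assms by simp

text \<open>One coordinate is integrated out at a time: Hoelder's inequality in that coordinate
  bounds the left-hand side for \<open>f\<close> by the one for its marginal. For \<open>q = 1 / (card I - 1)\<close>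
  the first factor disappears, which is the case needed for the Sobolev inequality.\<close>

lemma gridlines_nn_integral:
  fixes f :: "('i \<Rightarrow> real) \<Rightarrow> ennreal" and q :: real
  assumes "finite I" "0 \<le> q" "(real (card I) - 1) * q \<le> 1"
    and "f \<in> borel_measurable (\<Pi>\<^sub>M i\<in>I. lborel)"
  shows "(\<integral>\<^sup>+y. epowr (f y) (1 - (real (card I) - 1) * q)
              * (\<Prod>i\<in>I. epowr (\<integral>\<^sup>+t. f (y(i := t)) \<partial>lborel) q) \<partial>(\<Pi>\<^sub>M i\<in>I. lborel))
    \<le> epowr (\<integral>\<^sup>+y. f y \<partial>(\<Pi>\<^sub>M i\<in>I. lborel)) (1 + q)"
  using assms(1,3,4)
proof (induction I arbitrary: f rule: finite_induct)
  \<comment> \<open>The left exponent is \<open>1 - (0 - 1) * q = 1 + q\<close>, the product is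
    empty and the space is a single point, so both sides agree.\<close>
  case empty
  then show ?case by (simp add: PiM_empty nn_integral_count_space_finite)
next
  case (insert i I)
  interpret product_sigma_finite "\<lambda>_::'i. lborel :: real measure" by standard
  note [measurable] = insert.prems(2)
  define m where "m = real (card I)"
  define g where "g x = (\<integral>\<^sup>+t. f (x(i := t)) \<partial>lborel)" for x
  have m: "real (card (insert i I)) - 1 = m" "0 \<le> m"
    using insert by (simp_all add: m_def)
  have mq: "m * q \<le> 1" "0 \<le> m * q" "(m - 1) * q \<le> 1"
    using insert.prems(1) assms(2) m mult_right_mono[of "m - 1" m q] by auto
  have [measurable]: "g \<in> borel_measurable (\<Pi>\<^sub>M i\<in>I. lborel)"
    unfolding g_def by measurable
  have upd [measurable]: "(\<lambda>y. \<integral>\<^sup>+t. f (y(j := t)) \<partial>lborel) \<in> borel_measurable (\<Pi>\<^sub>M i\<in>insert i I. lborel)"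
    if j: "j \<in> insert i I" for j
  proof -
    have [measurable]: "(\<lambda>z. (fst z)(j := snd z)) \<in>
        measurable ((\<Pi>\<^sub>M i\<in>insert i I. lborel) \<Otimes>\<^sub>M lborel) (\<Pi>\<^sub>M i\<in>insert i I. lborel)"
      using j by (intro measurable_fun_upd[where J = "insert i I"]) auto
    show ?thesis
      by (intro sigma_finite_measure.borel_measurable_nn_integral sigma_finite_lborel)
        (simp add: split_beta')
  qed
  have "(\<integral>\<^sup>+y. epowr (f y) (1 - m * q) * (\<Prod>j\<in>insert i I. epowr (\<integral>\<^sup>+t. f (y(j := t)) \<partial>lborel) q)
          \<partial>(\<Pi>\<^sub>M i\<in>insert i I. lborel))
      = (\<integral>\<^sup>+x. (\<integral>\<^sup>+t. epowr (f (x(i := t))) (1 - m * q)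
            * (\<Prod>j\<in>insert i I. epowr (\<integral>\<^sup>+\<tau>. f (x(i := t, j := \<tau>)) \<partial>lborel) q) \<partial>lborel) \<partial>(\<Pi>\<^sub>M i\<in>I. lborel))"
    by (subst product_nn_integral_insert[OF insert.hyps(1,2)]) simp_all
  also have "\<dots> \<le> (\<integral>\<^sup>+x. epowr (g x) (1 - (m - 1) * q)
              * (\<Prod>j\<in>I. epowr (\<integral>\<^sup>+t. g (x(j := t)) \<partial>lborel) q) \<partial>(\<Pi>\<^sub>M i\<in>I. lborel))"
  proof (intro nn_integral_mono)
    fix x :: "'i \<Rightarrow> real" assume x: "x \<in> space (\<Pi>\<^sub>M i\<in>I. lborel)"
    have [measurable]: "(\<lambda>t. x(i := t)) \<in> measurable lborel (\<Pi>\<^sub>M i\<in>insert i I. lborel)"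
      using x by (intro measurable_fun_upd[where J = I]) auto
    define F where "F j t = (\<integral>\<^sup>+\<tau>. f (x(i := t, j := \<tau>)) \<partial>lborel)" for j t
    have F[measurable]: "F j \<in> borel_measurable lborel" if "j \<in> I" for j
      using measurable_compose[OF \<open>(\<lambda>t. x(i := t)) \<in> _\<close> upd[of j]] that by (simp add: F_def[abs_def])
    have Fint: "(\<integral>\<^sup>+t. F j t \<partial>lborel) = (\<integral>\<^sup>+t. g (x(j := t)) \<partial>lborel)" if j: "j \<in> I" for j
    proof -
      have ij: "i \<noteq> j" using j insert.hyps by auto
      have [measurable]: "(\<lambda>z. x(i := snd z, j := fst z)) \<in>
          measurable (lborel \<Otimes>\<^sub>M lborel) (\<Pi>\<^sub>M i\<in>insert i I. lborel)"
        using j x by (intro measurable_fun_upd[where J = "insert i I"]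
            measurable_fun_upd[where J = I]) auto
      \<comment> \<open>Tonelli's theorem; updates at the distinct coordinates \<open>i\<close> and
        \<open>j\<close> commute, so the inner integral over coordinate \<open>i\<close> becomes the
        marginal \<open>g\<close>.\<close>
      have "(\<integral>\<^sup>+t. F j t \<partial>lborel) = (\<integral>\<^sup>+\<tau>. (\<integral>\<^sup>+t. f (x(i := t, j := \<tau>)) \<partial>lborel) \<partial>lborel)"
        unfolding F_def by (intro lborel_pair.Fubini') (simp add: split_beta')
      also have "\<dots> = (\<integral>\<^sup>+t. g (x(j := t)) \<partial>lborel)"
        using ij by (simp add: g_def fun_upd_twist)
      finally show ?thesis .
    qed
    \<comment> \<open>The factor for \<open>j = i\<close> is constant in \<open>t\<close>, since the
      second update overwrites the first; it leaves the integral as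
      \<open>epowr (g x) q\<close>.\<close>
    have "(\<integral>\<^sup>+t. epowr (f (x(i := t))) (1 - m * q)
            * (\<Prod>j\<in>insert i I. epowr (\<integral>\<^sup>+\<tau>. f (x(i := t, j := \<tau>)) \<partial>lborel) q) \<partial>lborel)
        = (\<integral>\<^sup>+t. epowr (g x) q * (epowr (f (x(i := t))) (1 - m * q) * (\<Prod>j\<in>I. epowr (F j t) q)) \<partial>lborel)"
      using insert.hyps by (simp add: g_def F_def ac_simps)
    also have "\<dots> = epowr (g x) q * (\<integral>\<^sup>+t. epowr (f (x(i := t))) (1 - m * q) * (\<Prod>j\<in>I. epowr (F j t) q) \<partial>lborel)"
      by (intro nn_integral_cmult) simp
    \<comment> \<open>Hoelder in \<open>t\<close>, with weight \<open>1 - m * q\<close> for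
      \<open>f\<close> and weight \<open>q\<close> for each of the \<open>m\<close> remaining
      coordinates; these weights add up to 1.\<close>
    also have "\<dots> \<le> epowr (g x) q * (epowr (g x) (1 - m * q) * (\<Prod>j\<in>I. epowr (\<integral>\<^sup>+t. F j t \<partial>lborel) q))"
      unfolding g_def using insert.hyps mq assms(2) 
      by (intro mult_left_mono Hoelder_nn_integral_insert) (auto simp: m_def)
    \<comment> \<open>The collected exponent is \<open>1 - (m - 1) * q\<close>, the one that the
      induction hypothesis has for the smaller set \<open>I\<close>.\<close>
    also have "\<dots> = epowr (g x) (q + (1 - m * q)) * (\<Prod>j\<in>I. epowr (\<integral>\<^sup>+t. g (x(j := t)) \<partial>lborel) q)"
      using mq assms(2) by (subst epowr_add) (auto simp: Fint ac_simps)
    finally show "(\<integral>\<^sup>+t. epowr (f (x(i := t))) (1 - m * q)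
            * (\<Prod>j\<in>insert i I. epowr (\<integral>\<^sup>+\<tau>. f (x(i := t, j := \<tau>)) \<partial>lborel) q) \<partial>lborel)
        \<le> epowr (g x) (1 - (m - 1) * q) * (\<Prod>j\<in>I. epowr (\<integral>\<^sup>+t. g (x(j := t)) \<partial>lborel) q)"
      by (simp add: algebra_simps)
  qed
  also have "\<dots> \<le> epowr (\<integral>\<^sup>+x. g x \<partial>(\<Pi>\<^sub>M i\<in>I. lborel)) (1 + q)"
    using insert.IH[of g] mq by (simp add: m_def del: fun_upd_apply)
  also have "(\<integral>\<^sup>+x. g x \<partial>(\<Pi>\<^sub>M i\<in>I. lborel)) = (\<integral>\<^sup>+y. f y \<partial>(\<Pi>\<^sub>M i\<in>insert i I. lborel))"
    unfolding g_def by (intro product_nn_integral_insert[symmetric] insert.hyps) simp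
  finally show ?case unfolding m .
qed

section \<open>The Gagliardo-Nirenberg inequality\<close>

text \<open>Away from 0 the absolute value is locally \<open>x\<close> or \<open>- x\<close>. At 0
  the difference quotient is bounded by |h|^(s - 1), which tends to 0 because
  \<open>s > 1\<close>.\<close>

lemma has_real_derivative_abs_powr:
  fixes s x :: real
  assumes "1 < s"
  shows "((\<lambda>x. \<bar>x\<bar> powr s) has_real_derivative s * \<bar>x\<bar> powr (s - 1) * sgn x) (at x)"
proof -
  consider "0 < x" | "x < 0" | "x = 0" by linarith
  then show ?thesis
  proof cases
    case 1
    have "((\<lambda>x. x powr s) has_real_derivative s * x powr (s - 1)) (at x)"
      using 1 by (rule has_real_derivative_powr)
    then have "((\<lambda>x. \<bar>x\<bar> powr s) has_real_derivative s * x powr (s - 1)) (at x)"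
      by (rule has_field_derivative_transform_within_open[of _ _ _ "{0<..}"]) (use 1 in auto)
    then show ?thesis using 1 by simp
  next
    case 2
    have "((\<lambda>x. (- x) powr s) has_real_derivative s * (- x) powr (s - 1) * (- 1)) (at x)"
      using 2 by (intro DERIV_chain2[OF has_real_derivative_powr]) (auto intro!: derivative_eq_intros)
    then have "((\<lambda>x. \<bar>x\<bar> powr s) has_real_derivative s * (- x) powr (s - 1) * (- 1)) (at x)"
      by (rule has_field_derivative_transform_within_open[of _ _ _ "{..<0}"]) (use 2 in auto)
    then show ?thesis using 2 by simp
  next
    case 3
    have "((\<lambda>h::real. \<bar>h\<bar> powr (s - 1)) \<longlongrightarrow> 0) (at 0)"
      using assms by (intro tendsto_zero_powrI[where b = "s - 1"]) (auto intro!: tendsto_eq_intros)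
    moreover have "\<forall>\<^sub>F h in at 0. norm (\<bar>h\<bar> powr s / h) \<le> \<bar>h\<bar> powr (s - 1)"
    proof (rule eventuallyI)
      fix h :: real
      show "norm (\<bar>h\<bar> powr s / h) \<le> \<bar>h\<bar> powr (s - 1)"
        using powr_diff[of "\<bar>h\<bar>" s 1] by (cases "h = 0") (auto simp: abs_divide)
    qed
    ultimately have "((\<lambda>h::real. \<bar>h\<bar> powr s / h) \<longlongrightarrow> 0) (at 0)"
      by (rule Lim_null_comparison[rotated])
    then show ?thesis using 3 by (simp add: DERIV_def)
  qed
qed

text \<open>The jump of \<open>sgn\<close> at 0 is damped by a factor tending to 0. With
  \<open>s - 1\<close> in place of \<open>s\<close> this gives the continuity of the derivative
  above, as the fundamental theorem of calculus requires.\<close>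

lemma continuous_on_abs_powr_sgn:
  fixes s :: real
  assumes "0 < s"
  shows "continuous_on UNIV (\<lambda>x::real. \<bar>x\<bar> powr s * sgn x)"
proof (unfold continuous_on_eq_continuous_at[OF open_UNIV], intro ballI)
  fix x :: real
  show "isCont (\<lambda>x. \<bar>x\<bar> powr s * sgn x) x"
  proof (cases "x = 0")
    case True
    have "((\<lambda>h::real. \<bar>h\<bar> powr s) \<longlongrightarrow> 0) (at 0)"
      using assms by (intro tendsto_zero_powrI[where b = s]) (auto intro!: tendsto_eq_intros)
    then have "((\<lambda>h::real. \<bar>h\<bar> powr s * sgn h) \<longlongrightarrow> 0) (at 0)"
      by (rule Lim_null_comparison[rotated]) (auto simp: abs_mult abs_sgn_eq)
    then show ?thesis using True by (simp add: isCont_def)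
  next
    case False
    then show ?thesis
      unfolding isCont_def by (intro tendsto_intros) auto
  qed
qed

text \<open>The fundamental theorem of calculus for |h|^s, started at a zero of \<open>h\<close> to
  the left of \<open>x\<close>; the absolute value of the derivative is then integrated over the
  whole line.\<close>

lemma abs_powr_le_nn_integral_deriv:
  fixes h h' :: "real \<Rightarrow> real" and a s x :: real
  assumes h: "\<And>t. (h has_real_derivative h' t) (at t)" and h': "continuous_on UNIV h'"
    and "1 < s" and vanish: "\<And>t. t \<le> a \<Longrightarrow> h t = 0"
  shows "ennreal (\<bar>h x\<bar> powr s) \<le> (\<integral>\<^sup>+t. ennreal (s * \<bar>h t\<bar> powr (s - 1) * \<bar>h' t\<bar>) \<partial>lborel)"
proof -
  \<comment> \<open>The minimum ensures \<open>h b = 0\<close> together with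
    \<open>b \<le> x\<close>, also when \<open>x\<close> lies to the left of
    \<open>a\<close>.\<close>
  define b where "b = min a x"
  define k where "k t = s * (\<bar>h t\<bar> powr (s - 1) * sgn (h t)) * h' t" for t
  have "b \<le> x" "h b = 0" using vanish by (auto simp: b_def)
  have "continuous_on UNIV h"
    using h by (intro DERIV_continuous_on) auto
  then have k: "continuous_on UNIV k"
    unfolding k_def using assms(3)
    by (intro continuous_intros h' continuous_on_compose2[OF continuous_on_abs_powr_sgn]) auto
  have "((\<lambda>t. \<bar>h t\<bar> powr s) has_real_derivative k t) (at t)" for t
    using DERIV_chain2[OF has_real_derivative_abs_powr[OF assms(3)] h[of t]] by (simp add: k_def mult.assoc)
  then have "(\<integral>t. indicator {b..x} t *\<^sub>R k t \<partial>lborel) = \<bar>h x\<bar> powr s - \<bar>h b\<bar> powr s"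
    using \<open>b \<le> x\<close> k
    by (intro integral_FTC_atLeastAtMost)
      (auto simp: has_real_derivative_iff_has_vector_derivative intro: has_vector_derivative_at_within continuous_on_subset)
  then have "ennreal (\<bar>h x\<bar> powr s) = ennreal (norm (\<integral>t. indicator {b..x} t *\<^sub>R k t \<partial>lborel))"
    using \<open>h b = 0\<close> by simp
  also have "\<dots> \<le> (\<integral>\<^sup>+t. norm (indicator {b..x} t *\<^sub>R k t) \<partial>lborel)"
    using k by (intro integral_norm_bound_ennreal borel_integrable_compact) (auto intro: continuous_on_subset)
  also have "\<dots> \<le> (\<integral>\<^sup>+t. ennreal (s * \<bar>h t\<bar> powr (s - 1) * \<bar>h' t\<bar>) \<partial>lborel)"
    using assms(3)
    by (intro nn_integral_mono ennreal_leI) (auto simp: k_def abs_mult abs_sgn_eq split: split_indicator)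
  finally show ?thesis .
qed

section \<open>Compactly supported C^1 functions\<close>

lemma C1c_continuous:
  assumes "C1c U u du"
  shows "continuous_on UNIV u" "continuous_on UNIV du"
  using assms unfolding C1c_def
  by (auto simp: continuous_on_eq_continuous_at intro: has_derivative_continuous)

lemma C1c_measurable:
  assumes "C1c U u du"
  shows "u \<in> borel_measurable borel" "du \<in> borel_measurable borel"
  using C1c_continuous[OF assms] by (auto intro: borel_measurable_continuous_onI)

text \<open>The gradient vanishes off the same \<open>K\<close>, because the complement of a compact
  set is open and \<open>u\<close> is constant there.\<close>

lemma C1c_support:
  assumes "C1c U u du"
  obtains K where "compact K" "K \<subseteq> U" "\<And>x. x \<notin> K \<Longrightarrow> u x = 0" "\<And>x. x \<notin> K \<Longrightarrow> du x = 0"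
proof -
  obtain K where K: "compact K" "K \<subseteq> U" "\<And>x. x \<notin> K \<Longrightarrow> u x = 0"
    and d: "\<And>x. (u has_derivative (\<lambda>h. du x \<bullet> h)) (at x)"
    using assms unfolding C1c_def by blast
  have "du x = 0" if "x \<notin> K" for x
  proof -
    have "(u has_derivative (\<lambda>h. 0)) (at x)"
      using K that
      by (intro has_derivative_transform_within_open[OF has_derivative_const[of 0], where s = "- K"])
         (auto dest: compact_imp_closed)
    from has_derivative_unique[OF d this] have "du x \<bullet> du x = 0" by metis
    then show ?thesis by simp
  qed
  with K show thesis using that by blast
qed

lemma nn_integral_compact_support_finite:
  fixes h :: "'a::euclidean_space \<Rightarrow> real"
  assumes "continuous_on UNIV h" "compact K" "\<And>x. x \<notin> K \<Longrightarrow> h x = 0"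
  shows "(\<integral>\<^sup>+x. ennreal (h x) \<partial>lborel) < top"
proof -
  have "integrable lborel (\<lambda>x. indicator K x *\<^sub>R h x)"
    using assms by (intro borel_integrable_compact) (auto intro: continuous_on_subset)
  also have "(\<lambda>x. indicator K x *\<^sub>R h x) = h"
    using assms(3) by (auto simp: fun_eq_iff split: split_indicator)
  finally have "(\<integral>\<^sup>+x. ennreal (norm (h x)) \<partial>lborel) < \<infinity>"
    by (simp add: integrable_iff_bounded)
  moreover have "(\<integral>\<^sup>+x. ennreal (h x) \<partial>lborel) \<le> (\<integral>\<^sup>+x. ennreal (norm (h x)) \<partial>lborel)"
    by (intro nn_integral_mono ennreal_leI) auto
  ultimately show ?thesis by auto
qed

lemma C1c_finite_integrals:
  fixes u :: "'a::euclidean_space \<Rightarrow> real"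
  assumes "C1c U u du"
  shows "0 < q \<Longrightarrow> (\<integral>\<^sup>+x. ennreal (\<bar>u x\<bar> powr q) \<partial>lborel) < top"
    and "(\<integral>\<^sup>+x. ennreal ((u x)\<^sup>2) \<partial>lborel) < top"
    and "(\<integral>\<^sup>+x. ennreal ((norm (du x))\<^sup>2) \<partial>lborel) < top"
proof -
  obtain K where K: "compact K" "K \<subseteq> U" "\<And>x. x \<notin> K \<Longrightarrow> u x = 0" "\<And>x. x \<notin> K \<Longrightarrow> du x = 0"
    using C1c_support[OF assms] by metis
  note c = C1c_continuous[OF assms]
  show "0 < q \<Longrightarrow> (\<integral>\<^sup>+x. ennreal (\<bar>u x\<bar> powr q) \<partial>lborel) < top"
    using c K by (intro nn_integral_compact_support_finite[OF _ K(1)] continuous_on_powr' continuous_intros) auto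
  show "(\<integral>\<^sup>+x. ennreal ((u x)\<^sup>2) \<partial>lborel) < top" "(\<integral>\<^sup>+x. ennreal ((norm (du x))\<^sup>2) \<partial>lborel) < top"
    using c K by (auto intro!: nn_integral_compact_support_finite[OF _ K(1)] continuous_intros)
qed

section \<open>Coordinate lines and the L^1 Sobolev inequality\<close>

text \<open>This map carries the product measure over \<open>Basis\<close> to \<open>lborel\<close>,
  so that integrals over the space take the form treated in
  \<open>gridlines_nn_integral\<close>.\<close>

definition of_coords :: "('a::euclidean_space \<Rightarrow> real) \<Rightarrow> 'a" where
  "of_coords y = (\<Sum>b\<in>Basis. y b *\<^sub>R b)"

lemma of_coords_upd:
  "i \<in> Basis \<Longrightarrow> of_coords (y(i := t)) = (\<Sum>b\<in>Basis - {i}. y b *\<^sub>R b) + t *\<^sub>R i"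
  unfolding of_coords_def by (subst sum.remove[of _ i]) (auto simp: add.commute)

lemma measurable_of_coords [measurable]:
  "of_coords \<in> borel_measurable (\<Pi>\<^sub>M b\<in>(Basis::'a::euclidean_space set). lborel)"
  unfolding of_coords_def by measurable

lemma nn_integral_lborel_coords:
  fixes F :: "'a::euclidean_space \<Rightarrow> ennreal"
  assumes "F \<in> borel_measurable borel"
  shows "(\<integral>\<^sup>+x. F x \<partial>lborel) = (\<integral>\<^sup>+y. F (of_coords y) \<partial>(\<Pi>\<^sub>M b\<in>Basis. lborel))"
proof -
  have "(\<integral>\<^sup>+x. F x \<partial>lborel) = (\<integral>\<^sup>+x. F x \<partial>(distr (\<Pi>\<^sub>M b\<in>Basis. lborel) borel of_coords))"
    by (subst lborel_eq) (simp add: of_coords_def[abs_def])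
  then show ?thesis
    using assms by (simp add: nn_integral_distr)
qed

text \<open>The one-dimensional estimate on the line through the point in direction
  \<open>i\<close>; the derivative along a unit vector is at most the norm of the gradient.\<close>

lemma C1c_powr_le_line_integral:
  fixes u :: "'a::euclidean_space \<Rightarrow> real"
  assumes "C1c U u du" "i \<in> Basis" "1 < s"
  shows "ennreal (\<bar>u (of_coords y)\<bar> powr s) \<le>
    (\<integral>\<^sup>+t. ennreal (s * \<bar>u (of_coords (y(i := t)))\<bar> powr (s - 1) * norm (du (of_coords (y(i := t))))) \<partial>lborel)"
proof -
  define z where "z = (\<Sum>b\<in>Basis - {i}. y b *\<^sub>R b)"
  have upd: "of_coords (y(i := t)) = z + t *\<^sub>R i" for t
    using assms(2) by (simp add: z_def of_coords_upd)
  have y: "of_coords y = z + y i *\<^sub>R i"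
    using upd[of "y i"] by simp
  obtain K where K: "compact K" "\<And>x. x \<notin> K \<Longrightarrow> u x = 0"
    using C1c_support[OF assms(1)] by metis
  obtain B where B: "\<And>x. x \<in> K \<Longrightarrow> norm x \<le> B"
    using compact_imp_bounded[OF K(1)] by (auto simp: bounded_iff)
  have d: "(u has_derivative (\<lambda>h. du x \<bullet> h)) (at x)" for x
    using assms(1) by (simp add: C1c_def)
  have "ennreal (\<bar>u (z + y i *\<^sub>R i)\<bar> powr s) \<le>
      (\<integral>\<^sup>+t. ennreal (s * \<bar>u (z + t *\<^sub>R i)\<bar> powr (s - 1) * \<bar>du (z + t *\<^sub>R i) \<bullet> i\<bar>) \<partial>lborel)"
  proof (rule abs_powr_le_nn_integral_deriv)
    fix t
    have "((\<lambda>t. u (z + t *\<^sub>R i)) has_derivative (\<lambda>h. du (z + t *\<^sub>R i) \<bullet> (h *\<^sub>R i))) (at t)"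
      by (intro has_derivative_compose[OF _ d]) (auto intro!: derivative_eq_intros)
    then show "((\<lambda>t. u (z + t *\<^sub>R i)) has_real_derivative du (z + t *\<^sub>R i) \<bullet> i) (at t)"
      by (simp add: has_field_derivative_def mult_commute_abs)
  next
    show "continuous_on UNIV (\<lambda>t. du (z + t *\<^sub>R i) \<bullet> i)"
      by (intro continuous_intros continuous_on_compose2[OF C1c_continuous(2)[OF assms(1)]]) auto
  next
    \<comment> \<open>By the triangle inequality such a \<open>t\<close> moves the point out of the
      ball of radius \<open>B\<close> containing \<open>K\<close>. The absolute value covers a
      negative \<open>B\<close>, which is possible for empty \<open>K\<close>.\<close>
    fix t :: real assume "t \<le> - (\<bar>B\<bar> + norm z + 1)"
    then have "B < norm (z + t *\<^sub>R i)"
      using norm_triangle_ineq4[of "z + t *\<^sub>R i" z] assms(2) by simp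
    then show "u (z + t *\<^sub>R i) = 0"
      using B K(2) by force
  qed fact
  also have "\<dots> \<le> (\<integral>\<^sup>+t. ennreal (s * \<bar>u (z + t *\<^sub>R i)\<bar> powr (s - 1) * norm (du (z + t *\<^sub>R i))) \<partial>lborel)"
    using assms(2,3) by (intro nn_integral_mono ennreal_leI mult_left_mono Basis_le_norm) auto
  finally show ?thesis unfolding upd y .
qed

text \<open>This is the L^1 Sobolev inequality for |u|^s. The bounds by line integrals in all
  \<open>n\<close> directions are raised to the power \<open>1 / (n - 1)\<close> and multiplied, and
  the integral of the product is estimated by \<open>gridlines_nn_integral\<close>.\<close>

lemma Sobolev_C1c_powr:
  fixes u :: "'a::euclidean_space \<Rightarrow> real"
  assumes "C1c U u du" "1 < s" "2 \<le> DIM('a)"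
  defines "n \<equiv> real DIM('a)"
  shows "(\<integral>\<^sup>+x. ennreal (\<bar>u x\<bar> powr (s * (n / (n - 1)))) \<partial>lborel)
    \<le> epowr (\<integral>\<^sup>+x. ennreal (s * \<bar>u x\<bar> powr (s - 1) * norm (du x)) \<partial>lborel) (n / (n - 1))"
proof -
  note [measurable] = C1c_measurable[OF assms(1)]
  define f where "f x = ennreal (s * \<bar>u x\<bar> powr (s - 1) * norm (du x))" for x
  define q where "q = 1 / (n - 1)"
  have n: "2 \<le> n" using assms(3) by (simp add: n_def)
  have q: "0 < q" "(n - 1) * q = 1" "1 + q = n / (n - 1)"
    using n by (auto simp: q_def field_simps)
  have [measurable]: "f \<in> borel_measurable borel"
    unfolding f_def by measurable
  have "(\<integral>\<^sup>+x. ennreal (\<bar>u x\<bar> powr (s * (n / (n - 1)))) \<partial>lborel)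
      = (\<integral>\<^sup>+y. ennreal (\<bar>u (of_coords y)\<bar> powr (s * (n / (n - 1)))) \<partial>(\<Pi>\<^sub>M b\<in>Basis. lborel))"
    by (intro nn_integral_lborel_coords) measurable
  also have "\<dots> \<le> (\<integral>\<^sup>+y. (\<Prod>i\<in>Basis. epowr (\<integral>\<^sup>+t. f (of_coords (y(i := t))) \<partial>lborel) q) \<partial>(\<Pi>\<^sub>M b\<in>Basis. lborel))"
  proof (intro nn_integral_mono)
    fix y :: "'a \<Rightarrow> real"
    \<comment> \<open>The exponent \<open>n / (n - 1)\<close> is distributed evenly: one factor with
      exponent \<open>q\<close> for each of the \<open>n\<close> directions.\<close>
    have "ennreal (\<bar>u (of_coords y)\<bar> powr (s * (n / (n - 1))))
        = (\<Prod>i\<in>(Basis::'a set). ennreal ((\<bar>u (of_coords y)\<bar> powr s) powr q))"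
      using n by (cases "u (of_coords y) = 0")
        (auto simp: ennreal_power powr_powr powr_realpow[symmetric] n_def q_def ac_simps)
    also have "\<dots> = (\<Prod>i\<in>(Basis::'a set). epowr (ennreal (\<bar>u (of_coords y)\<bar> powr s)) q)"
      using q by (simp add: epowr_ennreal pow0_def)
    also have "\<dots> \<le> (\<Prod>i\<in>Basis. epowr (\<integral>\<^sup>+t. f (of_coords (y(i := t))) \<partial>lborel) q)"
      using q unfolding f_def
      by (intro prod_mono_ennreal epowr_mono C1c_powr_le_line_integral[OF assms(1) _ assms(2)]) auto
    finally show "ennreal (\<bar>u (of_coords y)\<bar> powr (s * (n / (n - 1)))) \<le> \<dots>" .
  qed
  also have "\<dots> \<le> epowr (\<integral>\<^sup>+y. f (of_coords y) \<partial>(\<Pi>\<^sub>M b\<in>Basis. lborel)) (n / (n - 1))"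
    using gridlines_nn_integral[of "Basis::'a set" q "\<lambda>y. f (of_coords y)"] q
    by (simp add: n_def[symmetric] del: fun_upd_apply)
  also have "\<dots> = epowr (\<integral>\<^sup>+x. f x \<partial>lborel) (n / (n - 1))"
    by (subst nn_integral_lborel_coords[of f]) auto
  finally show ?thesis unfolding f_def .
qed

section \<open>Interpolation and absorption for C^1 functions\<close>

text \<open>Dividing by \<open>epowr X d\<close> is legitimate because \<open>X\<close> is finite
  and, in the nontrivial case, not 0; the remaining exponent \<open>1 - d\<close> is positive and
  can be inverted.\<close>

lemma epowr_absorb:
  fixes X Y :: ennreal
  assumes "X \<noteq> top" "X \<le> Y * epowr X d" "0 \<le> d" "d < 1"
  shows "X \<le> epowr Y (1 / (1 - d))"
proof (cases "X = 0")
  case False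
  have "epowr X d * epowr X (1 - d) = X"
    using assms(3,4) by (subst epowr_add[symmetric]) auto
  then have "epowr X d * epowr X (1 - d) \<le> epowr X d * Y"
    using assms(2) by (simp add: mult.commute)
  then have "epowr X (1 - d) \<le> Y"
    using False assms(1) by (subst (asm) ennreal_mult_le_mult_iff) (auto simp: epowr_eq_0_iff epowr_eq_top_iff)
  then have "epowr (epowr X (1 - d)) (1 / (1 - d)) \<le> epowr Y (1 / (1 - d))"
    using assms(4) by (intro epowr_mono) auto
  then show ?thesis
    using assms(4) by (simp add: epowr_epowr)
qed simp

lemma ennreal_square_eq_epowr: "ennreal (x\<^sup>2) = epowr (ennreal \<bar>x\<bar>) 2"
  by (simp add: epowr_ennreal pow0_def powr_numeral)

lemma ennreal_powr_eq_epowr: "q \<noteq> 0 \<Longrightarrow> ennreal (\<bar>x\<bar> powr q) = epowr (ennreal \<bar>x\<bar>) q"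
  by (simp add: epowr_ennreal pow0_def)

text \<open>The Hoelder weights are 1/2 for the squared gradient, \<open>(1 - \<theta>) / 2\<close>
  for u^2 and \<open>\<theta> / 2\<close> for |u|^q. The lower bound on \<open>q\<close> yields
  \<open>0 \<le> \<theta>\<close>, the upper bound \<open>\<theta> \<le> 1\<close>.\<close>

lemma Gagliardo_Nirenberg_C1c_dim_ge_2:
  fixes q :: real and \<Omega> :: "'a::euclidean_space set"
  assumes "2 \<le> DIM('a)"
  defines "n \<equiv> real DIM('a)"
  assumes q: "2 + 4 / n \<le> q" "3 \<le> n \<Longrightarrow> q \<le> 2 * n / (n - 2)"
  obtains C where "0 < C" "\<And>u du. C1c \<Omega> u du \<Longrightarrow>
    (\<integral>\<^sup>+x. ennreal (\<bar>u x\<bar> powr q) \<partial>lborel) \<le> ennreal C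
      * epowr (\<integral>\<^sup>+x. ennreal ((u x)\<^sup>2) \<partial>lborel) (q / 2 - n * (q - 2) / 4)
      * epowr (\<integral>\<^sup>+x. ennreal ((norm (du x))\<^sup>2) \<partial>lborel) (n * (q - 2) / 4)"
proof -
  have n: "2 \<le> n" using assms(1) by (simp add: n_def)
  \<comment> \<open>\<open>n'\<close> is the Sobolev exponent; \<open>s * n' = q\<close> makes the
    Sobolev inequality return the integral of |u|^q; \<open>\<theta>\<close> solves
    \<open>2 * (1 - \<theta>) + q * \<theta> = 2 * s - 2\<close>; \<open>d\<close> is the power of
    that integral appearing on the right.\<close>
  define n' where "n' = n / (n - 1)"
  define s where "s = q / n'"
  define \<theta> where "\<theta> = 2 * (s - 2) / (q - 2)"
  define d where "d = \<theta> * n' / 2"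
  have n': "1 < n'" "n' - 1 = 1 / (n - 1)" "n' \<le> 2"
    using n by (auto simp: n'_def field_simps)
  have "0 < 4 / n" using n by simp
  then have q2: "2 < q" using q(1) by linarith
  have s_eq: "s = q - q / n"
    using n by (simp add: s_def n'_def field_simps)
  have "2 * n / (n - 1) \<le> 2 + 4 / n"
    using n by (simp add: field_simps)
  then have "2 * n' \<le> q" using q(1) by (simp add: n'_def)
  then have s2: "2 \<le> s" using n'(1) by (simp add: s_def le_divide_eq)
  have \<theta>0: "0 \<le> \<theta>" using s2 q2 by (simp add: \<theta>_def)
  \<comment> \<open>Subcriticality in a form that also covers \<open>n = 2\<close>, where the left
    side is 0; it is equivalent to \<open>\<theta> \<le> 1\<close>.\<close>
  have "q * (n - 2) \<le> 2 * n"
  proof (cases "n = 2")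
    case False
    then have "3 \<le> n" using assms(1) by (simp add: n_def)
    then show ?thesis using q(2) by (simp add: field_simps)
  qed simp
  then have "2 * (s - 2) \<le> q - 2"
    using n by (simp add: s_eq field_simps)
  then have \<theta>1: "\<theta> \<le> 1" using q2 by (simp add: \<theta>_def)
  \<comment> \<open>Since \<open>n' > 1\<close>, this gives \<open>d < 1\<close>, so the power of
    the integral of |u|^q can be absorbed.\<close>
  have d_eq: "1 - d = 2 * (n' - 1) / (q - 2)"
    using q2 n'(1) by (simp add: d_def \<theta>_def s_def field_simps)
  have d: "0 \<le> d" "d < 1"
  proof -
    show "0 \<le> d" using \<theta>0 n'(1) by (simp add: d_def)
    have "0 < 2 * (n' - 1) / (q - 2)" using n'(1) q2 by simp
    then show "d < 1" unfolding d_eq[symmetric] by simp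
  qed
  \<comment> \<open>Absorption raises everything to the power \<open>1 / (1 - d)\<close>;
    \<open>e1\<close> and \<open>e2\<close> identify the resulting exponents of the gradient
    integral and of the mass.\<close>
  have e1: "n' / 2 * (1 / (1 - d)) = n * (q - 2) / 4"
    unfolding d_eq n'(2) using n q2 by (simp add: n'_def field_simps)
  have cancel: "(x - 1 + y) * (1 / y) = x * (1 / y) - 1 / y + 1" if "y \<noteq> 0" for x y :: real
    using that by (simp add: field_simps)
  have "1 / (1 - d) = (n - 1) * (q - 2) / 2"
    unfolding d_eq n'(2) using n q2 by (simp add: field_simps)
  moreover have exp_eq: "(1 - \<theta>) / 2 * n' = n' / 2 - 1 + (1 - d)"
    by (simp add: d_def field_simps)
  have "(1 - \<theta>) / 2 * n' * (1 / (1 - d)) = n' / 2 * (1 / (1 - d)) - 1 / (1 - d) + 1"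
    unfolding exp_eq by (rule cancel) (use d in simp)
  ultimately have e2: "(1 - \<theta>) / 2 * n' * (1 / (1 - d)) = q / 2 - n * (q - 2) / 4"
    unfolding e1 by (simp add: field_simps)
  \<comment> \<open>The factor \<open>s\<close> from differentiating |u|^s passes through the powers
    \<open>n'\<close> and \<open>1 / (1 - d)\<close>.\<close>
  define C where "C = s powr (n' * (1 / (1 - d)))"
  have "0 < C" using s2 by (simp add: C_def)
  moreover have "(\<integral>\<^sup>+x. ennreal (\<bar>u x\<bar> powr q) \<partial>lborel) \<le> ennreal C
      * epowr (\<integral>\<^sup>+x. ennreal ((u x)\<^sup>2) \<partial>lborel) (q / 2 - n * (q - 2) / 4)
      * epowr (\<integral>\<^sup>+x. ennreal ((norm (du x))\<^sup>2) \<partial>lborel) (n * (q - 2) / 4)"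
    if u: "C1c \<Omega> u du" for u du
  proof -
    note [measurable] = C1c_measurable[OF u]
    define X where "X = (\<integral>\<^sup>+x. ennreal (\<bar>u x\<bar> powr q) \<partial>lborel)"
    define m where "m = (\<integral>\<^sup>+x. ennreal ((u x)\<^sup>2) \<partial>lborel)"
    define G where "G = (\<integral>\<^sup>+x. ennreal ((norm (du x))\<^sup>2) \<partial>lborel)"
    have "X \<noteq> top"
      using C1c_finite_integrals(1)[OF u, of q] q2 by (simp add: X_def)
    \<comment> \<open>The index type \<open>bool\<close> labels the mass factor by
      \<open>True\<close> and the |u|^q factor by \<open>False\<close>; the gradient factor is the
      one split off.\<close>
    have split: "ennreal (s * \<bar>u x\<bar> powr (s - 1) * norm (du x)) = ennreal s *
        (epowr (ennreal ((norm (du x))\<^sup>2)) (1 / 2) *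
          (\<Prod>b\<in>UNIV. epowr (ennreal (if b then (u x)\<^sup>2 else \<bar>u x\<bar> powr q)) (if b then (1 - \<theta>) / 2 else \<theta> / 2)))" for x
    proof -
      have "\<theta> * (q - 2) = 2 * (s - 2)"
        using q2 by (simp add: \<theta>_def)
      then have s_split: "2 * ((1 - \<theta>) / 2) + q * (\<theta> / 2) = s - 1"
        by (simp add: field_simps)
      have "ennreal (\<bar>u x\<bar> powr (s - 1)) = epowr (ennreal \<bar>u x\<bar>) (2 * ((1 - \<theta>) / 2) + q * (\<theta> / 2))"
        unfolding s_split using s2 by (intro ennreal_powr_eq_epowr) auto
      also have "\<dots> = epowr (ennreal ((u x)\<^sup>2)) ((1 - \<theta>) / 2) * epowr (ennreal (\<bar>u x\<bar> powr q)) (\<theta> / 2)"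
        using \<theta>0 \<theta>1 q2
        by (subst epowr_add) (auto simp: ennreal_square_eq_epowr ennreal_powr_eq_epowr epowr_epowr)
      finally have 1: "ennreal (\<bar>u x\<bar> powr (s - 1)) = \<dots>" .
      have 2: "ennreal (norm (du x)) = epowr (ennreal ((norm (du x))\<^sup>2)) (1 / 2)"
        by (simp add: ennreal_square_eq_epowr epowr_epowr)
      have "ennreal (s * \<bar>u x\<bar> powr (s - 1) * norm (du x))
          = ennreal s * ennreal (\<bar>u x\<bar> powr (s - 1)) * ennreal (norm (du x))"
        using s2 by (simp add: ennreal_mult)
      then show ?thesis
        unfolding 1 2 by (simp add: UNIV_bool ac_simps)
    qed
    have "(\<integral>\<^sup>+x. ennreal (s * \<bar>u x\<bar> powr (s - 1) * norm (du x)) \<partial>lborel) = ennreal s *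
        (\<integral>\<^sup>+x. epowr (ennreal ((norm (du x))\<^sup>2)) (1 / 2) *
          (\<Prod>b\<in>UNIV. epowr (ennreal (if b then (u x)\<^sup>2 else \<bar>u x\<bar> powr q)) (if b then (1 - \<theta>) / 2 else \<theta> / 2)) \<partial>lborel)"
      unfolding split by (intro nn_integral_cmult) measurable
    also have "\<dots> \<le> ennreal s * (epowr (\<integral>\<^sup>+x. ennreal ((norm (du x))\<^sup>2) \<partial>lborel) (1 / 2) *
          (\<Prod>b\<in>UNIV. epowr (\<integral>\<^sup>+x. ennreal (if b then (u x)\<^sup>2 else \<bar>u x\<bar> powr q) \<partial>lborel)
              (if b then (1 - \<theta>) / 2 else \<theta> / 2)))"
      using \<theta>0 \<theta>1 by (intro mult_left_mono Hoelder_nn_integral_insert) (auto simp: UNIV_bool field_simps)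
    also have "\<dots> = ennreal s * epowr m ((1 - \<theta>) / 2) * epowr G (1 / 2) * epowr X (\<theta> / 2)"
      by (simp add: UNIV_bool m_def G_def X_def ac_simps)
    finally have f: "(\<integral>\<^sup>+x. ennreal (s * \<bar>u x\<bar> powr (s - 1) * norm (du x)) \<partial>lborel) \<le> \<dots>" .
    have "X = (\<integral>\<^sup>+x. ennreal (\<bar>u x\<bar> powr (s * (n / (n - 1)))) \<partial>lborel)"
      using n by (simp add: X_def s_def n'_def)
    also have "\<dots> \<le> epowr (\<integral>\<^sup>+x. ennreal (s * \<bar>u x\<bar> powr (s - 1) * norm (du x)) \<partial>lborel) n'"
      unfolding n'_def n_def using u s2 assms(1) by (intro Sobolev_C1c_powr) auto
    also have "\<dots> \<le> epowr (ennreal s * epowr m ((1 - \<theta>) / 2) * epowr G (1 / 2) * epowr X (\<theta> / 2)) n'"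
      using n' by (intro epowr_mono f) auto
    also have "\<dots> = (epowr (ennreal s) n' * epowr m ((1 - \<theta>) / 2 * n') * epowr G (n' / 2)) * epowr X d"
      using n' \<theta>0 \<theta>1 by (simp add: epowr_mult epowr_epowr d_def)
    finally have "X \<le> epowr (epowr (ennreal s) n' * epowr m ((1 - \<theta>) / 2 * n') * epowr G (n' / 2)) (1 / (1 - d))"
      by (intro epowr_absorb[OF \<open>X \<noteq> top\<close>] d)
    also have "\<dots> = epowr (ennreal s) (n' * (1 / (1 - d))) * epowr m ((1 - \<theta>) / 2 * n' * (1 / (1 - d)))
        * epowr G (n' / 2 * (1 / (1 - d)))"
      using d n' \<theta>1 by (simp add: epowr_mult epowr_epowr)
    also have "epowr (ennreal s) (n' * (1 / (1 - d))) = ennreal C"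
      using s2 d n' by (simp add: C_def epowr_ennreal pow0_def)
    finally show ?thesis
      unfolding e1 e2 X_def m_def G_def .
  qed
  ultimately show thesis by (rule that)
qed

text \<open>The line estimate with exponent 2 and the Cauchy-Schwarz inequality bound u^2 uniformly
  by twice the geometric mean of mass and gradient integral. This bound is inserted into |u|^q =
  (u^2)^((q - 2)/2) u^2.\<close>

lemma Gagliardo_Nirenberg_C1c_dim_1:
  fixes u :: "'a::euclidean_space \<Rightarrow> real"
  assumes "DIM('a) = 1" and q: "2 \<le> q" and u: "C1c \<Omega> u du"
  shows "(\<integral>\<^sup>+x. ennreal (\<bar>u x\<bar> powr q) \<partial>lborel) \<le> ennreal (2 powr ((q - 2) / 2))
      * epowr (\<integral>\<^sup>+x. ennreal ((u x)\<^sup>2) \<partial>lborel) (q / 2 - (q - 2) / 4)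
      * epowr (\<integral>\<^sup>+x. ennreal ((norm (du x))\<^sup>2) \<partial>lborel) ((q - 2) / 4)"
proof -
  note [measurable] = C1c_measurable[OF u]
  obtain i :: 'a where i: "Basis = {i}"
    using assms(1) card_1_singletonE by blast
  define m where "m = (\<integral>\<^sup>+x. ennreal ((u x)\<^sup>2) \<partial>lborel)"
  define G where "G = (\<integral>\<^sup>+x. ennreal ((norm (du x))\<^sup>2) \<partial>lborel)"
  define f where "f x = ennreal (2 * \<bar>u x\<bar> powr (2 - 1) * norm (du x))" for x
  have [measurable]: "f \<in> borel_measurable borel" unfolding f_def by measurable
  interpret product_sigma_finite "\<lambda>_::'a. lborel :: real measure" by standard
  \<comment> \<open>The only coordinate line is the whole space, so the line integral does not
    depend on \<open>y\<close>.\<close>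
  have line: "(\<integral>\<^sup>+t. f (of_coords (y(i := t))) \<partial>lborel) = (\<integral>\<^sup>+x. f x \<partial>lborel)" for y
  proof -
    have "(\<integral>\<^sup>+x. f x \<partial>lborel) = (\<integral>\<^sup>+y. f (y i *\<^sub>R i) \<partial>(\<Pi>\<^sub>M b\<in>{i}. lborel))"
      by (subst nn_integral_lborel_coords) (simp_all add: of_coords_def i)
    also have "\<dots> = (\<integral>\<^sup>+t. f (t *\<^sub>R i) \<partial>lborel)"
      by (rule product_nn_integral_singleton) simp
    finally show ?thesis by (simp add: of_coords_def i)
  qed
  have "(\<integral>\<^sup>+x. f x \<partial>lborel) = (\<integral>\<^sup>+x. 2 * (epowr (ennreal ((u x)\<^sup>2)) (1 / 2) * epowr (ennreal ((norm (du x))\<^sup>2)) (1 / 2)) \<partial>lborel)"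
    by (simp add: f_def ennreal_square_eq_epowr epowr_epowr ennreal_mult mult.assoc)
  also have "\<dots> \<le> 2 * (epowr m (1 / 2) * epowr G (1 / 2))"
    unfolding m_def G_def
    by (subst nn_integral_cmult) (auto intro!: mult_left_mono Hoelder2_nn_integral)
  finally have f: "(\<integral>\<^sup>+x. f x \<partial>lborel) \<le> \<dots>" .
  have sup: "ennreal ((u x)\<^sup>2) \<le> 2 * (epowr m (1 / 2) * epowr G (1 / 2))" for x
  proof -
    have x: "of_coords (\<lambda>b. x \<bullet> b) = x"
      by (simp add: of_coords_def euclidean_representation)
    have "ennreal ((u x)\<^sup>2) = ennreal (\<bar>u (of_coords (\<lambda>b. x \<bullet> b))\<bar> powr 2)"
      unfolding x by (simp add: powr_numeral)
    also have "\<dots> \<le> (\<integral>\<^sup>+t. f (of_coords ((\<lambda>b. x \<bullet> b)(i := t))) \<partial>lborel)"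
      unfolding f_def by (intro C1c_powr_le_line_integral[OF u]) (auto simp: i)
    finally show ?thesis unfolding line using f by (rule order_trans)
  qed
  have "(\<integral>\<^sup>+x. ennreal (\<bar>u x\<bar> powr q) \<partial>lborel)
      \<le> (\<integral>\<^sup>+x. epowr (2 * (epowr m (1 / 2) * epowr G (1 / 2))) ((q - 2) / 2) * ennreal ((u x)\<^sup>2) \<partial>lborel)"
  proof (intro nn_integral_mono)
    fix x
    have "ennreal (\<bar>u x\<bar> powr q) = epowr (ennreal \<bar>u x\<bar>) ((q - 2) + 2)"
      using q by (simp add: ennreal_powr_eq_epowr)
    also have "\<dots> = epowr (ennreal ((u x)\<^sup>2)) ((q - 2) / 2) * ennreal ((u x)\<^sup>2)"
      using q by (subst epowr_add) (auto simp: ennreal_square_eq_epowr epowr_epowr diff_divide_distrib)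
    also have "\<dots> \<le> epowr (2 * (epowr m (1 / 2) * epowr G (1 / 2))) ((q - 2) / 2) * ennreal ((u x)\<^sup>2)"
      using q by (intro mult_right_mono epowr_mono sup) auto
    finally show "ennreal (\<bar>u x\<bar> powr q) \<le> \<dots>" .
  qed
  also have "\<dots> = epowr (2 * (epowr m (1 / 2) * epowr G (1 / 2))) ((q - 2) / 2) * m"
    unfolding m_def by (intro nn_integral_cmult) measurable
  also have "\<dots> = epowr 2 ((q - 2) / 2) * (epowr m ((q - 2) / 4) * epowr m 1) * epowr G ((q - 2) / 4)"
    using q by (simp add: epowr_mult epowr_epowr ac_simps)
  also have "epowr m ((q - 2) / 4) * epowr m 1 = epowr m (q / 2 - (q - 2) / 4)"
    using q by (subst epowr_add[symmetric]) (auto simp: field_simps)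
  also have "epowr 2 ((q - 2) / 2) = ennreal (2 powr ((q - 2) / 2))"
    using epowr_ennreal[of 2 "(q - 2) / 2"] by (simp add: pow0_def)
  finally show ?thesis by (simp add: m_def G_def)
qed

lemma Gagliardo_Nirenberg_C1c:
  fixes q :: real and \<Omega> :: "'a::euclidean_space set"
  defines "n \<equiv> real DIM('a)"
  assumes q: "2 + 4 / n \<le> q" "3 \<le> n \<Longrightarrow> q \<le> 2 * n / (n - 2)"
  obtains C where "0 < C" "\<And>u du. C1c \<Omega> u du \<Longrightarrow>
    (\<integral>\<^sup>+x. ennreal (\<bar>u x\<bar> powr q) \<partial>lborel) \<le> ennreal C
      * epowr (\<integral>\<^sup>+x. ennreal ((u x)\<^sup>2) \<partial>lborel) (q / 2 - n * (q - 2) / 4)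
      * epowr (\<integral>\<^sup>+x. ennreal ((norm (du x))\<^sup>2) \<partial>lborel) (n * (q - 2) / 4)"
proof (cases "DIM('a) = 1")
  case True
  then have n: "n = 1" by (simp add: n_def)
  show thesis
    using q True by (intro that[of "2 powr ((q - 2) / 2)"])
      (auto simp: n intro: Gagliardo_Nirenberg_C1c_dim_1[where 'a = 'a, simplified])
next
  case False
  moreover have "0 < DIM('a)" by simp
  ultimately have "2 \<le> DIM('a)" by linarith
  from Gagliardo_Nirenberg_C1c_dim_ge_2[where 'a = 'a, OF this q[unfolded n_def], of \<Omega>] that
  show thesis unfolding n_def by metis
qed

section \<open>Passage to limits in H^1_0 and D^{1,2}\<close>

text \<open>A subsequence converges almost everywhere, and Fatou's lemma carries the bound over. The
  exponents \<open>e\<close> and \<open>q\<close> are kept apart because the approximation is in L^2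
  for \<open>H10\<close> and in the critical Lebesgue space for \<open>D12\<close>.\<close>

lemma nn_integral_powr_le_of_tendsto:
  fixes phi :: "nat \<Rightarrow> 'a::euclidean_space \<Rightarrow> real"
  assumes [measurable]: "\<And>k. phi k \<in> borel_measurable borel" "u \<in> borel_measurable borel"
    and "0 < e" "0 < q"
    and conv: "(\<lambda>k. \<integral>\<^sup>+x. ennreal (\<bar>phi k x - u x\<bar> powr e) \<partial>lborel) \<longlonglongrightarrow> 0"
    and bound: "\<forall>\<^sub>F k in sequentially. (\<integral>\<^sup>+x. ennreal (\<bar>phi k x\<bar> powr q) \<partial>lborel) \<le> Z"
  shows "(\<integral>\<^sup>+x. ennreal (\<bar>u x\<bar> powr q) \<partial>lborel) \<le> Z"
proof -
  have "\<forall>\<^sub>F k in sequentially. (\<integral>\<^sup>+x. ennreal (\<bar>phi k x - u x\<bar> powr e) \<partial>lborel) < top"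
    using conv by (rule order_tendstoD) simp
  from eventually_conj[OF this bound] obtain k0 where k0: "\<And>k. k0 \<le> k \<Longrightarrow> (\<integral>\<^sup>+x. ennreal (\<bar>phi k x - u x\<bar> powr e) \<partial>lborel) < top"
    "\<And>k. k0 \<le> k \<Longrightarrow> (\<integral>\<^sup>+x. ennreal (\<bar>phi k x\<bar> powr q) \<partial>lborel) \<le> Z"
    unfolding eventually_sequentially by auto
  \<comment> \<open>Dropping the first \<open>k0\<close> terms turns the eventual finiteness and the
    eventual bound into statements about all indices.\<close>
  define v where "v k x = \<bar>phi (k + k0) x - u x\<bar> powr e" for k x
  have int: "integrable lborel (v k)" for k
    unfolding v_def by (intro integrableI_nonneg) (auto simp: k0)
  have "(\<lambda>k. enn2real (\<integral>\<^sup>+x. ennreal (v k x) \<partial>lborel)) \<longlonglongrightarrow> enn2real 0"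
    using conv[THEN LIMSEQ_ignore_initial_segment, of k0]
    by (intro tendsto_enn2real) (auto simp: v_def)
  moreover have "enn2real (\<integral>\<^sup>+x. ennreal (v k x) \<partial>lborel) = (\<integral>x. norm (v k x) \<partial>lborel)" for k
    using int[of k] by (subst integral_eq_nn_integral) (auto simp: v_def)
  ultimately obtain r :: "nat \<Rightarrow> nat" where r: "AE x in lborel. (\<lambda>n. v (r n) x) \<longlonglongrightarrow> 0"
    using tendsto_L1_AE_subseq[of lborel v, OF int] by auto
  have "AE x in lborel. liminf (\<lambda>n. ennreal (\<bar>phi (r n + k0) x\<bar> powr q)) = ennreal (\<bar>u x\<bar> powr q)"
    using r
  proof eventually_elim
    case (elim x)
    have "(\<lambda>n. v (r n) x powr (1 / e)) \<longlonglongrightarrow> 0"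
      using elim \<open>0 < e\<close> by (intro tendsto_zero_powrI[where b = "1 / e"]) (auto simp: v_def)
    then have "(\<lambda>n. \<bar>phi (r n + k0) x - u x\<bar>) \<longlonglongrightarrow> 0"
      using \<open>0 < e\<close> by (simp add: v_def powr_powr)
    then have "(\<lambda>n. phi (r n + k0) x) \<longlonglongrightarrow> u x"
      by (simp add: LIM_zero_iff tendsto_rabs_zero_iff)
    then have "(\<lambda>n. \<bar>phi (r n + k0) x\<bar> powr q) \<longlonglongrightarrow> \<bar>u x\<bar> powr q"
      using \<open>0 < q\<close> by (intro tendsto_powr2 tendsto_intros) auto
    then show ?case
      by (intro lim_imp_Liminf tendsto_ennrealI) auto
  qed
  then have "(\<integral>\<^sup>+x. ennreal (\<bar>u x\<bar> powr q) \<partial>lborel)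
      = (\<integral>\<^sup>+x. liminf (\<lambda>n. ennreal (\<bar>phi (r n + k0) x\<bar> powr q)) \<partial>lborel)"
    by (intro nn_integral_cong_AE) (auto elim: eventually_mono)
  also have "\<dots> \<le> liminf (\<lambda>n. \<integral>\<^sup>+x. ennreal (\<bar>phi (r n + k0) x\<bar> powr q) \<partial>lborel)"
    by (intro nn_integral_liminf) measurable
  also have "\<dots> \<le> liminf (\<lambda>n. Z)"
    by (intro Liminf_mono always_eventually allI k0) auto
  finally show ?thesis by (simp add: Liminf_const)
qed

lemma nn_integral_norm_sq_le:
  fixes f g :: "'a::euclidean_space \<Rightarrow> 'b::euclidean_space"
  assumes [measurable]: "f \<in> borel_measurable borel" "g \<in> borel_measurable borel"
  shows "(\<integral>\<^sup>+x. ennreal ((norm (f x))\<^sup>2) \<partial>lborel) \<le>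
    2 * (\<integral>\<^sup>+x. ennreal ((norm (g x))\<^sup>2) \<partial>lborel) + 2 * (\<integral>\<^sup>+x. ennreal ((norm (f x - g x))\<^sup>2) \<partial>lborel)"
proof -
  have "(\<integral>\<^sup>+x. ennreal ((norm (f x))\<^sup>2) \<partial>lborel)
      \<le> (\<integral>\<^sup>+x. 2 * ennreal ((norm (g x))\<^sup>2) + 2 * ennreal ((norm (f x - g x))\<^sup>2) \<partial>lborel)"
  proof (intro nn_integral_mono)
    fix x
    have "norm (f x) \<le> norm (g x) + norm (f x - g x)"
      using norm_triangle_ineq[of "g x" "f x - g x"] by simp
    then have "(norm (f x))\<^sup>2 \<le> (norm (g x) + norm (f x - g x))\<^sup>2"
      by (intro power_mono) auto
    also have "\<dots> \<le> 2 * (norm (g x))\<^sup>2 + 2 * (norm (f x - g x))\<^sup>2"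
      using sum_squares_bound[of "norm (g x)" "norm (f x - g x)"] by (simp add: power2_sum)
    finally have "ennreal ((norm (f x))\<^sup>2) \<le> ennreal (2 * (norm (g x))\<^sup>2 + 2 * (norm (f x - g x))\<^sup>2)"
      by (rule ennreal_leI)
    then show "ennreal ((norm (f x))\<^sup>2) \<le> 2 * ennreal ((norm (g x))\<^sup>2) + 2 * ennreal ((norm (f x - g x))\<^sup>2)"
      by (simp add: ennreal_plus ennreal_mult)
  qed
  then show ?thesis by (simp add: nn_integral_add nn_integral_cmult)
qed

text \<open>The bound is 2K + 2K once the squared distance to the limit is below \<open>K\<close>.
  This requires \<open>K > 0\<close>, so limits of norm 0 are treated separately in the
  applications.\<close>

lemma eventually_L2_bound:
  fixes f :: "nat \<Rightarrow> 'a::euclidean_space \<Rightarrow> 'b::euclidean_space"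
  assumes "\<And>k. f k \<in> borel_measurable borel" "g \<in> borel_measurable borel"
    and "(\<lambda>k. \<integral>\<^sup>+x. ennreal ((norm (f k x - g x))\<^sup>2) \<partial>lborel) \<longlonglongrightarrow> 0"
    and "(\<integral>\<^sup>+x. ennreal ((norm (g x))\<^sup>2) \<partial>lborel) \<le> ennreal K" "0 < K"
  shows "\<forall>\<^sub>F k in sequentially. (\<integral>\<^sup>+x. ennreal ((norm (f k x))\<^sup>2) \<partial>lborel) \<le> ennreal (4 * K)"
proof -
  have "\<forall>\<^sub>F k in sequentially. (\<integral>\<^sup>+x. ennreal ((norm (f k x - g x))\<^sup>2) \<partial>lborel) < ennreal K"
    using assms(3) by (rule order_tendstoD) (use assms(5) in simp)
  then show ?thesis
  proof eventually_elim
    case (elim k)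
    have "(\<integral>\<^sup>+x. ennreal ((norm (f k x))\<^sup>2) \<partial>lborel) \<le> 2 * (\<integral>\<^sup>+x. ennreal ((norm (g x))\<^sup>2) \<partial>lborel)
        + 2 * (\<integral>\<^sup>+x. ennreal ((norm (f k x - g x))\<^sup>2) \<partial>lborel)"
      using assms(1,2) by (rule nn_integral_norm_sq_le)
    also have "\<dots> \<le> 2 * ennreal K + 2 * ennreal K"
      using elim assms(4) by (intro add_mono mult_left_mono) auto
    also have "\<dots> = ennreal (4 * K)"
      using assms(5) by (simp add: ennreal_mult distrib_right[symmetric])
    finally show ?case .
  qed
qed

lemma L2_limit_finite:
  fixes f :: "nat \<Rightarrow> 'a::euclidean_space \<Rightarrow> 'b::euclidean_space"
  assumes [measurable]: "\<And>k. f k \<in> borel_measurable borel" "g \<in> borel_measurable borel"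
    and conv: "(\<lambda>k. \<integral>\<^sup>+x. ennreal ((norm (f k x - g x))\<^sup>2) \<partial>lborel) \<longlonglongrightarrow> 0"
    and fin: "\<And>k. (\<integral>\<^sup>+x. ennreal ((norm (f k x))\<^sup>2) \<partial>lborel) < top"
  shows "(\<integral>\<^sup>+x. ennreal ((norm (g x))\<^sup>2) \<partial>lborel) < top"
proof -
  have "\<forall>\<^sub>F k in sequentially. (\<integral>\<^sup>+x. ennreal ((norm (f k x - g x))\<^sup>2) \<partial>lborel) < top"
    using conv by (rule order_tendstoD) simp
  then obtain k where "(\<integral>\<^sup>+x. ennreal ((norm (f k x - g x))\<^sup>2) \<partial>lborel) < top"
    by (auto simp: eventually_sequentially)
  moreover have "(\<integral>\<^sup>+x. ennreal ((norm (g x))\<^sup>2) \<partial>lborel) \<le> 2 * (\<integral>\<^sup>+x. ennreal ((norm (f k x))\<^sup>2) \<partial>lborel)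
      + 2 * (\<integral>\<^sup>+x. ennreal ((norm (g x - f k x))\<^sup>2) \<partial>lborel)"
    by (intro nn_integral_norm_sq_le) auto
  ultimately show ?thesis
    using fin[of k] by (auto simp: norm_minus_commute less_top[symmetric] top_unique ennreal_mult_eq_top_iff)
qed

lemma H10_cases:
  assumes "(u, g) \<in> H10 \<Omega>"
  obtains phi dphi where "u \<in> borel_measurable borel" "g \<in> borel_measurable borel"
    "\<And>k. C1c \<Omega> (phi k) (dphi k)"
    "(\<lambda>k. \<integral>\<^sup>+x. ennreal ((phi k x - u x)\<^sup>2) \<partial>lborel) \<longlonglongrightarrow> 0"
    "(\<lambda>k. \<integral>\<^sup>+x. ennreal ((norm (dphi k x - g x))\<^sup>2) \<partial>lborel) \<longlonglongrightarrow> 0"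
  using assms unfolding H10_def by auto

lemma H10_measurable:
  assumes "(u, g) \<in> H10 \<Omega>"
  shows "u \<in> borel_measurable borel" "g \<in> borel_measurable borel"
  using assms unfolding H10_def by auto

lemma H10_square_integrable:
  assumes "(u, g) \<in> H10 \<Omega>"
  shows "integrable lborel (\<lambda>x. (u x)\<^sup>2)" "integrable lborel (\<lambda>x. (norm (g x))\<^sup>2)"
proof -
  obtain phi dphi where H: "u \<in> borel_measurable borel" "g \<in> borel_measurable borel"
    "\<And>k. C1c \<Omega> (phi k) (dphi k)"
    "(\<lambda>k. \<integral>\<^sup>+x. ennreal ((phi k x - u x)\<^sup>2) \<partial>lborel) \<longlonglongrightarrow> 0"
    "(\<lambda>k. \<integral>\<^sup>+x. ennreal ((norm (dphi k x - g x))\<^sup>2) \<partial>lborel) \<longlonglongrightarrow> 0"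
    using H10_cases[OF assms] by blast
  note C = C1c_measurable[OF H(3)] C1c_finite_integrals(2,3)[OF H(3)]
  have "(\<integral>\<^sup>+x. ennreal ((u x)\<^sup>2) \<partial>lborel) < top" "(\<integral>\<^sup>+x. ennreal ((norm (g x))\<^sup>2) \<partial>lborel) < top"
    using L2_limit_finite[of phi u] L2_limit_finite[of dphi g] H C by auto
  then show "integrable lborel (\<lambda>x. (u x)\<^sup>2)" "integrable lborel (\<lambda>x. (norm (g x))\<^sup>2)"
    using H(1,2) by (auto intro!: integrableI_nonneg)
qed

text \<open>The inequality passes to the limit along approximating C^1 functions at the cost of
  factors 4. Stating it with a bound \<open>K\<close> lets both components of a pair be estimated by
  the total gradient term.\<close>

lemma Gagliardo_Nirenberg_H10:
  fixes q :: real and \<Omega> :: "'a::euclidean_space set"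
  defines "n \<equiv> real DIM('a)"
  assumes q: "2 + 4 / n \<le> q" "3 \<le> n \<Longrightarrow> q \<le> 2 * n / (n - 2)"
  obtains C where "0 < C" "\<And>u g m K. (u, g) \<in> H10 \<Omega> \<Longrightarrow> 0 < K \<Longrightarrow>
    (\<integral>x. (u x)\<^sup>2 \<partial>lborel) = m \<Longrightarrow> (\<integral>x. (norm (g x))\<^sup>2 \<partial>lborel) \<le> K \<Longrightarrow>
    (\<integral>\<^sup>+x. ennreal (\<bar>u x\<bar> powr q) \<partial>lborel)
      \<le> ennreal (C * pow0 m (q / 2 - n * (q - 2) / 4) * K powr (n * (q - 2) / 4))"
proof -
  define \<kappa> where "\<kappa> = q / 2 - n * (q - 2) / 4"
  define a where "a = n * (q - 2) / 4"
  have n: "1 \<le> n" by (simp add: n_def Suc_leI)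
  have "0 < 4 / n" using n by simp
  then have q2: "2 < q" using q(1) by linarith
  then have "0 < a" using n by (simp add: a_def)
  have "q * (n - 2) \<le> 2 * n"
  proof (cases "3 \<le> n")
    case True
    then show ?thesis using q(2) by (simp add: field_simps)
  next
    case False
    then have "n \<le> 2" unfolding n_def by simp
    then show ?thesis using q2 n by (smt (verit) mult_nonneg_nonpos)
  qed
  then have "0 \<le> \<kappa>" by (simp add: \<kappa>_def field_simps)
  obtain C where C: "0 < C" "\<And>u du. C1c \<Omega> u du \<Longrightarrow>
    (\<integral>\<^sup>+x. ennreal (\<bar>u x\<bar> powr q) \<partial>lborel) \<le> ennreal C
      * epowr (\<integral>\<^sup>+x. ennreal ((u x)\<^sup>2) \<partial>lborel) \<kappa>
      * epowr (\<integral>\<^sup>+x. ennreal ((norm (du x))\<^sup>2) \<partial>lborel) a"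
    by (rule Gagliardo_Nirenberg_C1c[of q \<Omega>, folded n_def, folded \<kappa>_def, folded a_def, OF q]) (assumption | rule that)+
  define C' where "C' = C * 4 powr \<kappa> * 4 powr a"
  have "0 < C'" using C by (simp add: C'_def)
  moreover have "(\<integral>\<^sup>+x. ennreal (\<bar>u x\<bar> powr q) \<partial>lborel) \<le> ennreal (C' * pow0 m \<kappa> * K powr a)"
    if ug: "(u, g) \<in> H10 \<Omega>" and "0 < K" and m: "(\<integral>x. (u x)\<^sup>2 \<partial>lborel) = m"
      and K: "(\<integral>x. (norm (g x))\<^sup>2 \<partial>lborel) \<le> K" for u g m K
  proof -
    obtain phi dphi where H: "u \<in> borel_measurable borel" "g \<in> borel_measurable borel"
      "\<And>k. C1c \<Omega> (phi k) (dphi k)"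
      "(\<lambda>k. \<integral>\<^sup>+x. ennreal ((phi k x - u x)\<^sup>2) \<partial>lborel) \<longlonglongrightarrow> 0"
      "(\<lambda>k. \<integral>\<^sup>+x. ennreal ((norm (dphi k x - g x))\<^sup>2) \<partial>lborel) \<longlonglongrightarrow> 0"
      using H10_cases[OF ug] by blast
    note [measurable] = H(1,2)
    have um: "(\<integral>\<^sup>+x. ennreal ((u x)\<^sup>2) \<partial>lborel) = ennreal m"
      using H10_square_integrable[OF ug] m by (subst nn_integral_eq_integral) auto
    have gK: "(\<integral>\<^sup>+x. ennreal ((norm (g x))\<^sup>2) \<partial>lborel) \<le> ennreal K"
      using H10_square_integrable[OF ug] K by (subst nn_integral_eq_integral) (auto intro: ennreal_leI)
    have "0 \<le> m" using m by (auto intro!: integral_nonneg_AE)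
    show ?thesis
    proof (cases "m = 0")
      case True
      then have "AE x in lborel. ennreal ((u x)\<^sup>2) = 0"
        using um by (subst nn_integral_0_iff_AE[symmetric]) auto
      then have "(\<integral>\<^sup>+x. ennreal (\<bar>u x\<bar> powr q) \<partial>lborel) = (\<integral>\<^sup>+(x::'a). 0 \<partial>lborel)"
        by (intro nn_integral_cong_AE) (auto elim: eventually_mono)
      then show ?thesis by simp
    next
      case False
      then have "0 < m" using \<open>0 \<le> m\<close> by simp
      note M = C1c_measurable[OF H(3)]
      have "\<forall>\<^sub>F k in sequentially. (\<integral>\<^sup>+x. ennreal ((norm (phi k x))\<^sup>2) \<partial>lborel) \<le> ennreal (4 * m)"
        using H um \<open>0 < m\<close> M by (intro eventually_L2_bound[of phi u]) auto
      moreover have "\<forall>\<^sub>F k in sequentially. (\<integral>\<^sup>+x. ennreal ((norm (dphi k x))\<^sup>2) \<partial>lborel) \<le> ennreal (4 * K)"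
        using H gK \<open>0 < K\<close> M by (intro eventually_L2_bound[of dphi g]) auto
      ultimately have "\<forall>\<^sub>F k in sequentially. (\<integral>\<^sup>+x. ennreal (\<bar>phi k x\<bar> powr q) \<partial>lborel)
          \<le> ennreal C * epowr (ennreal (4 * m)) \<kappa> * epowr (ennreal (4 * K)) a"
      proof eventually_elim
        case (elim k)
        then show ?case
          using \<open>0 \<le> \<kappa>\<close> \<open>0 < a\<close> 
          by (intro order_trans[OF C(2)[OF H(3)]] mult_mono epowr_mono) auto
      qed
      moreover have "(\<lambda>k. \<integral>\<^sup>+x. ennreal (\<bar>phi k x - u x\<bar> powr 2) \<partial>lborel) \<longlonglongrightarrow> 0"
        using H(4) by (simp add: powr_numeral)
      ultimately have "(\<integral>\<^sup>+x. ennreal (\<bar>u x\<bar> powr q) \<partial>lborel)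
          \<le> ennreal C * epowr (ennreal (4 * m)) \<kappa> * epowr (ennreal (4 * K)) a"
        using q2 M by (intro nn_integral_powr_le_of_tendsto[of phi u 2 q]) auto
      also have "\<dots> = ennreal (C' * pow0 m \<kappa> * K powr a)"
        using C(1) \<open>0 < m\<close> \<open>0 < K\<close> \<open>0 < a\<close>
        by (simp add: epowr_ennreal ennreal_mult[symmetric] C'_def)
           (simp add: pow0_def powr_mult ac_simps)
      finally show ?thesis .
    qed
  qed
  ultimately show thesis unfolding \<kappa>_def a_def by (rule that)
qed

text \<open>At the critical exponent the mass enters the Gagliardo-Nirenberg inequality with
  exponent 0, so only the gradient has to be controlled. The result makes the set of constants in
  \<open>sobolev_const\<close> nonempty.\<close>

lemma D12_sobolev:
  assumes "3 \<le> DIM('a::euclidean_space)"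
  defines "q \<equiv> two_star DIM('a)"
  obtains C where "\<And>(v :: 'a \<Rightarrow> real) g. (v, g) \<in> D12 \<Longrightarrow>
    (\<integral>x. \<bar>v x\<bar> powr q \<partial>lborel) \<le> C * (\<integral>x. (norm (g x))\<^sup>2 \<partial>lborel) powr (q / 2)"
proof -
  define n where "n = real DIM('a)"
  have n: "3 \<le> n" using assms(1) by (simp add: n_def)
  have q_eq: "q = 2 * n / (n - 2)" by (simp add: q_def two_star_def n_def)
  have "2 + 4 / n \<le> q" using n by (simp add: q_eq field_simps)
  moreover have "0 < 4 / n" using n by simp
  ultimately have q2: "2 < q" by linarith
  have e: "q / 2 - n * (q - 2) / 4 = 0" "n * (q - 2) / 4 = q / 2"
    using n by (auto simp: q_eq field_simps)
  obtain C where C: "0 < C" "\<And>(u :: 'a \<Rightarrow> real) du. C1c UNIV u du \<Longrightarrow>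
    (\<integral>\<^sup>+x. ennreal (\<bar>u x\<bar> powr q) \<partial>lborel) \<le> ennreal C
      * epowr (\<integral>\<^sup>+x. ennreal ((norm (du x))\<^sup>2) \<partial>lborel) (q / 2)"
    using Gagliardo_Nirenberg_C1c[of q "UNIV :: 'a set"] \<open>2 + 4 / n \<le> q\<close>
    unfolding n_def[symmetric] e by (auto simp: q_eq[symmetric])
  have "(\<integral>x. \<bar>v x\<bar> powr q \<partial>lborel) \<le> C * 4 powr (q / 2) * (\<integral>x. (norm (g x))\<^sup>2 \<partial>lborel) powr (q / 2)"
    if vg: "(v, g) \<in> D12" for v :: "'a \<Rightarrow> real" and g
  proof -
    obtain phi dphi where H: "v \<in> borel_measurable borel" "g \<in> borel_measurable borel"
      "\<And>k. C1c UNIV (phi k) (dphi k)"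
      "(\<lambda>k. \<integral>\<^sup>+x. ennreal (\<bar>phi k x - v x\<bar> powr q) \<partial>lborel) \<longlonglongrightarrow> 0"
      "(\<lambda>k. \<integral>\<^sup>+x. ennreal ((norm (dphi k x - g x))\<^sup>2) \<partial>lborel) \<longlonglongrightarrow> 0"
      using vg unfolding D12_def q_def by auto
    note [measurable] = H(1,2)
    note M = C1c_measurable[OF H(3)]
    define G where "G = (\<integral>x. (norm (g x))\<^sup>2 \<partial>lborel)"
    have "(\<integral>\<^sup>+x. ennreal ((norm (g x))\<^sup>2) \<partial>lborel) < top"
      using H M C1c_finite_integrals(3)[OF H(3)] by (intro L2_limit_finite[of dphi g]) auto
    then have gG: "(\<integral>\<^sup>+x. ennreal ((norm (g x))\<^sup>2) \<partial>lborel) = ennreal G"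
      unfolding G_def by (intro nn_integral_eq_integral integrableI_nonneg) auto
    have "0 \<le> G" by (simp add: G_def)
    have bound: "(\<integral>x. \<bar>v x\<bar> powr q \<partial>lborel) \<le> C * 4 powr (q / 2) * K powr (q / 2)"
      if "0 < K" "G \<le> K" for K
    proof -
      have "\<forall>\<^sub>F k in sequentially. (\<integral>\<^sup>+x. ennreal ((norm (dphi k x))\<^sup>2) \<partial>lborel) \<le> ennreal (4 * K)"
        using H that M gG by (intro eventually_L2_bound[of dphi g]) (auto intro: ennreal_leI)
      then have "\<forall>\<^sub>F k in sequentially. (\<integral>\<^sup>+x. ennreal (\<bar>phi k x\<bar> powr q) \<partial>lborel)
          \<le> ennreal C * epowr (ennreal (4 * K)) (q / 2)"
      proof eventually_elim
        case (elim k)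
        then show ?case
          using q2 by (intro order_trans[OF C(2)[OF H(3)]] mult_left_mono epowr_mono) auto
      qed
      then have "(\<integral>\<^sup>+x. ennreal (\<bar>v x\<bar> powr q) \<partial>lborel) \<le> ennreal C * epowr (ennreal (4 * K)) (q / 2)"
        using q2 M H(4) by (intro nn_integral_powr_le_of_tendsto[of phi v q q]) auto
      also have "\<dots> = ennreal (C * 4 powr (q / 2) * K powr (q / 2))"
        using C(1) that q2
        by (simp add: epowr_ennreal ennreal_mult[symmetric]) (simp add: pow0_def powr_mult ac_simps)
      finally have "enn2real (\<integral>\<^sup>+x. ennreal (\<bar>v x\<bar> powr q) \<partial>lborel) \<le> C * 4 powr (q / 2) * K powr (q / 2)"
        using C(1) by (intro enn2real_leI) auto
      then show ?thesis
        by (subst integral_eq_nn_integral) auto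
    qed
    show ?thesis
    proof (cases "G = 0")
      case True
      \<comment> \<open>For \<open>G = 0\<close> every positive \<open>K\<close> is a valid bound,
        and letting \<open>K\<close> tend to 0 forces the left-hand side to be at most 0.\<close>
      have "((\<lambda>K. C * 4 powr (q / 2) * K powr (q / 2)) \<longlongrightarrow> C * 4 powr (q / 2) * 0) (at_right 0)"
        using q2 by (intro tendsto_mult tendsto_const tendsto_zero_powrI[where b = "q / 2"])
          (auto simp: eventually_at_filter)
      moreover have "\<forall>\<^sub>F K in at_right (0::real). (\<integral>x. \<bar>v x\<bar> powr q \<partial>lborel) \<le> C * 4 powr (q / 2) * K powr (q / 2)"
        using True bound by (auto simp: eventually_at_filter)
      ultimately have "(\<integral>x. \<bar>v x\<bar> powr q \<partial>lborel) \<le> C * 4 powr (q / 2) * 0"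
        by (intro tendsto_lowerbound) auto
      then show ?thesis using True by (simp add: G_def)
    next
      case False
      then have "0 < G" using \<open>0 \<le> G\<close> by simp
      then show ?thesis using bound[OF _ order_refl] by (simp add: G_def)
    qed
  qed
  then show thesis by (rule that)
qed

section \<open>Test functions\<close>

lemma C1cI:
  assumes "\<And>x. (u has_derivative (\<lambda>h. du x \<bullet> h)) (at x)" "continuous_on UNIV du"
    "compact K" "K \<subseteq> U" "\<And>x. x \<notin> K \<Longrightarrow> u x = 0"
  shows "C1c U u du"
  using assms unfolding C1c_def by blast

lemma C1c_mono: "C1c U u du \<Longrightarrow> U \<subseteq> V \<Longrightarrow> C1c V u du"
  unfolding C1c_def by blast

lemma C1c_scale:
  assumes "C1c U u du"
  shows "C1c U (\<lambda>x. c * u x) (\<lambda>x. c *\<^sub>R du x)"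
proof -
  obtain K where K: "compact K" "K \<subseteq> U" "\<And>x. x \<notin> K \<Longrightarrow> u x = 0"
    using C1c_support[OF assms] by metis
  show ?thesis
  proof (rule C1cI[OF _ _ K(1,2)])
    show "((\<lambda>x. c * u x) has_derivative (\<lambda>h. (c *\<^sub>R du x) \<bullet> h)) (at x)" for x
      using assms unfolding C1c_def by (auto intro!: derivative_eq_intros)
    show "continuous_on UNIV (\<lambda>x. c *\<^sub>R du x)"
      using assms unfolding C1c_def by (auto intro!: continuous_intros)
  qed (use K(3) in simp)
qed

lemma C1c_in_H10:
  assumes "C1c \<Omega> u du"
  shows "(u, du) \<in> H10 \<Omega>"
  using assms C1c_measurable[OF assms] unfolding H10_def
  by (auto intro!: exI[of _ "\<lambda>_. u"] exI[of _ "\<lambda>_. du"])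

lemma C1c_in_D12:
  fixes u :: "'a::euclidean_space \<Rightarrow> real"
  assumes "C1c UNIV u du"
  shows "(u, du) \<in> D12"
  using assms C1c_measurable[OF assms] unfolding D12_def
  by (auto intro!: exI[of _ "\<lambda>_. u"] exI[of _ "\<lambda>_. du"])

lemma H10_scale:
  assumes "(u, g) \<in> H10 \<Omega>"
  shows "(\<lambda>x. c * u x, \<lambda>x. c *\<^sub>R g x) \<in> H10 \<Omega>"
proof -
  obtain phi dphi where H: "u \<in> borel_measurable borel" "g \<in> borel_measurable borel"
    "\<And>k. C1c \<Omega> (phi k) (dphi k)"
    "(\<lambda>k. \<integral>\<^sup>+x. ennreal ((phi k x - u x)\<^sup>2) \<partial>lborel) \<longlonglongrightarrow> 0"
    "(\<lambda>k. \<integral>\<^sup>+x. ennreal ((norm (dphi k x - g x))\<^sup>2) \<partial>lborel) \<longlonglongrightarrow> 0"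
    using H10_cases[OF assms] by blast
  note [measurable] = H(1,2) C1c_measurable[OF H(3)]
  have "(\<integral>\<^sup>+x. ennreal ((c * phi k x - c * u x)\<^sup>2) \<partial>lborel)
      = ennreal (c\<^sup>2) * (\<integral>\<^sup>+x. ennreal ((phi k x - u x)\<^sup>2) \<partial>lborel)" for k
    by (subst nn_integral_cmult[symmetric])
      (auto simp: ennreal_mult[symmetric] power_mult_distrib[symmetric] right_diff_distrib)
  moreover have "(\<integral>\<^sup>+x. ennreal ((norm (c *\<^sub>R dphi k x - c *\<^sub>R g x))\<^sup>2) \<partial>lborel)
      = ennreal (c\<^sup>2) * (\<integral>\<^sup>+x. ennreal ((norm (dphi k x - g x))\<^sup>2) \<partial>lborel)" for k
    by (subst nn_integral_cmult[symmetric])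
      (auto simp: ennreal_mult[symmetric] power_mult_distrib scaleR_diff_right[symmetric])
  moreover have "(\<lambda>k. ennreal (c\<^sup>2) * (\<integral>\<^sup>+x. ennreal ((phi k x - u x)\<^sup>2) \<partial>lborel)) \<longlonglongrightarrow> ennreal (c\<^sup>2) * 0"
    "(\<lambda>k. ennreal (c\<^sup>2) * (\<integral>\<^sup>+x. ennreal ((norm (dphi k x - g x))\<^sup>2) \<partial>lborel)) \<longlonglongrightarrow> ennreal (c\<^sup>2) * 0"
    by (rule ennreal_tendsto_cmult[OF _ H(4)] ennreal_tendsto_cmult[OF _ H(5)]; simp)+
  ultimately show ?thesis
    using C1c_scale[OF H(3), of c] unfolding H10_def
    by (auto intro!: exI[of _ "\<lambda>k x. c * phi k x"] exI[of _ "\<lambda>k x. c *\<^sub>R dphi k x"])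
qed

lemma has_real_derivative_pos_part_square:
  "((\<lambda>t::real. (max 0 t)\<^sup>2) has_real_derivative 2 * max 0 t) (at t)"
proof -
  consider "0 < t" | "t < 0" | "t = 0" by linarith
  then show ?thesis
  proof cases
    case 1
    have "((\<lambda>t. t\<^sup>2) has_real_derivative 2 * t) (at t)"
      by (auto intro!: derivative_eq_intros)
    then have "((\<lambda>t. (max 0 t)\<^sup>2) has_real_derivative 2 * t) (at t)"
      by (rule has_field_derivative_transform_within_open[of _ _ _ "{0<..}"]) (use 1 in auto)
    then show ?thesis using 1 by simp
  next
    case 2
    have "((\<lambda>t. (max 0 t)\<^sup>2) has_real_derivative 0) (at t)"
      by (rule has_field_derivative_transform_within_open[of "\<lambda>_. 0" _ _ "{..<0}"]) (use 2 in auto)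
    then show ?thesis using 2 by simp
  next
    case 3
    have "((\<lambda>h::real. \<bar>h\<bar>) \<longlongrightarrow> 0) (at 0)"
      by (auto intro!: tendsto_eq_intros)
    moreover have "\<forall>\<^sub>F h in at (0::real). norm ((max 0 h)\<^sup>2 / h) \<le> \<bar>h\<bar>"
      by (rule eventuallyI) (auto simp: max_def power2_eq_square)
    ultimately have "((\<lambda>h::real. (max 0 h)\<^sup>2 / h) \<longlongrightarrow> 0) (at 0)"
      by (rule Lim_null_comparison[rotated])
    then show ?thesis using 3 by (simp add: DERIV_def)
  qed
qed

text \<open>Squaring the positive part makes the gluing across the sphere C^1. The ball itself is
  the compact set required by \<open>C1c\<close>.\<close>

lemma C1c_bump:
  fixes c :: "'a::euclidean_space"
  assumes "0 \<le> R"
  shows "C1c (cball c R) (\<lambda>x. (max 0 (R\<^sup>2 - (x - c) \<bullet> (x - c)))\<^sup>2)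
    (\<lambda>x. (- 4 * max 0 (R\<^sup>2 - (x - c) \<bullet> (x - c))) *\<^sub>R (x - c))"
proof -
  have 1: "((\<lambda>x. R\<^sup>2 - (x - c) \<bullet> (x - c)) has_derivative (\<lambda>h. - 2 * ((x - c) \<bullet> h))) (at x)" for x
    by (auto intro!: derivative_eq_intros simp: inner_commute)
  show ?thesis
  proof (rule C1cI)
    show "((\<lambda>x. (max 0 (R\<^sup>2 - (x - c) \<bullet> (x - c)))\<^sup>2) has_derivative
        (\<lambda>h. ((- 4 * max 0 (R\<^sup>2 - (x - c) \<bullet> (x - c))) *\<^sub>R (x - c)) \<bullet> h)) (at x)" for x
      by (rule has_derivative_eq_rhs[OF has_derivative_compose[OF 1
            has_real_derivative_pos_part_square[unfolded has_field_derivative_def]]])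
         (auto simp: fun_eq_iff)
    show "continuous_on UNIV (\<lambda>x. (- 4 * max 0 (R\<^sup>2 - (x - c) \<bullet> (x - c))) *\<^sub>R (x - c))"
      by (intro continuous_intros)
    show "(max 0 (R\<^sup>2 - (x - c) \<bullet> (x - c)))\<^sup>2 = 0" if "x \<notin> cball c R" for x
    proof -
      have "R < norm (x - c)" using that by (simp add: dist_norm norm_minus_commute)
      then have "R\<^sup>2 \<le> (norm (x - c))\<^sup>2" using assms by (intro power_mono) auto
      then show ?thesis by (simp add: power2_norm_eq_inner)
    qed
  qed simp_all
qed

text \<open>The bump is positive on the open ball, which has positive measure; hence its mass is
  positive and can be normalised.\<close>

lemma C1c_normalized_exists:
  fixes c :: "'a::euclidean_space"
  assumes "0 < R"
  obtains u du where "C1c (cball c R) u du" "(\<integral>x. (u x)\<^sup>2 \<partial>lborel) = 1"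
proof -
  define b where "b x = (max 0 (R\<^sup>2 - (x - c) \<bullet> (x - c)))\<^sup>2" for x
  obtain db where b: "C1c (cball c R) b db"
    using C1c_bump[of R c] assms unfolding b_def[abs_def] by auto
  note [measurable] = C1c_measurable[OF b]
  note int = H10_square_integrable(1)[OF C1c_in_H10[OF b]]
  have "(\<integral>x. (b x)\<^sup>2 \<partial>lborel) \<noteq> 0"
  proof
    assume "(\<integral>x. (b x)\<^sup>2 \<partial>lborel) = 0"
    then have "AE x in lborel. (b x)\<^sup>2 = 0"
      using int by (subst (asm) integral_nonneg_eq_0_iff_AE) auto
    then have "AE x in lborel. x \<notin> ball c R"
    proof eventually_elim
      case (elim x)
      have "b x \<noteq> 0" if "norm (x - c) < R"
        using power_strict_mono[OF that, of 2] by (simp add: b_def power2_norm_eq_inner)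
      with elim show ?case by (auto simp: dist_norm norm_minus_commute)
    qed
    then have "ball c R \<in> null_sets lborel"
      by (subst AE_iff_null_sets) auto
    then have "measure lborel (ball c R) = 0"
      by (auto simp: null_sets_def measure_def)
    then show False using content_ball_pos[OF assms, of c] by simp
  qed
  moreover have "0 \<le> (\<integral>x. (b x)\<^sup>2 \<partial>lborel)" by simp
  ultimately have pos: "0 < (\<integral>x. (b x)\<^sup>2 \<partial>lborel)" by linarith
  show thesis
  proof (rule that)
    show "C1c (cball c R) (\<lambda>x. 1 / sqrt (\<integral>x. (b x)\<^sup>2 \<partial>lborel) * b x)
      (\<lambda>x. (1 / sqrt (\<integral>x. (b x)\<^sup>2 \<partial>lborel)) *\<^sub>R db x)"
      using b by (rule C1c_scale)
    show "(\<integral>x. (1 / sqrt (\<integral>x. (b x)\<^sup>2 \<partial>lborel) * b x)\<^sup>2 \<partial>lborel) = 1"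
      using pos unfolding power_mult_distrib by (subst integral_mult_right_zero) (simp add: power_divide)
  qed
qed

text \<open>A single bump bounds every constant in the set from below by \<open>X / Y\<close>. Here
  \<open>X > 0\<close> by unit mass, and \<open>Y > 0\<close> because the Sobolev inequality holds
  with some finite constant.\<close>

lemma sobolev_const_pos:
  assumes "3 \<le> DIM('a::euclidean_space)"
  shows "0 < sobolev_const TYPE('a)"
proof -
  define q where "q = two_star DIM('a)"
  have q: "0 < q" using assms by (simp add: q_def two_star_def)
  define A where "A = {S. \<forall>(v, g) \<in> (D12 :: (('a \<Rightarrow> real) \<times> ('a \<Rightarrow> 'a)) set).
      (\<integral>x. \<bar>v x\<bar> powr q \<partial>lborel) \<le> S * (\<integral>x. (norm (g x))\<^sup>2 \<partial>lborel) powr (q / 2)}"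
  obtain C where "\<And>(v :: 'a \<Rightarrow> real) g. (v, g) \<in> D12 \<Longrightarrow>
    (\<integral>x. \<bar>v x\<bar> powr q \<partial>lborel) \<le> C * (\<integral>x. (norm (g x))\<^sup>2 \<partial>lborel) powr (q / 2)"
    using D12_sobolev[OF assms] unfolding q_def by blast
  then have "C \<in> A" by (auto simp: A_def)
  obtain u :: "'a \<Rightarrow> real" and du where u: "C1c (cball 0 1) u du" "(\<integral>x. (u x)\<^sup>2 \<partial>lborel) = 1"
    using C1c_normalized_exists[of 1 0] by auto
  note [measurable] = C1c_measurable[OF u(1)]
  have D: "(u, du) \<in> D12"
    using u(1) by (intro C1c_in_D12) (auto intro: C1c_mono)
  define X where "X = (\<integral>x. \<bar>u x\<bar> powr q \<partial>lborel)"
  define Y where "Y = (\<integral>x. (norm (du x))\<^sup>2 \<partial>lborel) powr (q / 2)"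
  have "X \<noteq> 0"
  proof
    assume "X = 0"
    moreover have "integrable lborel (\<lambda>x. \<bar>u x\<bar> powr q)"
      using C1c_finite_integrals(1)[OF u(1) q] by (intro integrableI_nonneg) auto
    ultimately have "AE x in lborel. \<bar>u x\<bar> powr q = 0"
      unfolding X_def by (subst (asm) integral_nonneg_eq_0_iff_AE) auto
    then have "(\<integral>x. (u x)\<^sup>2 \<partial>lborel) = (\<integral>(x::'a). 0 \<partial>lborel)"
      by (intro integral_cong_AE) (auto elim: eventually_mono)
    then show False using u(2) by simp
  qed
  moreover have "0 \<le> X" by (simp add: X_def)
  ultimately have "0 < X" by simp
  have XY: "X \<le> S * Y" if "S \<in> A" for S
    using that D by (auto simp: A_def X_def Y_def)
  have "0 \<le> Y" by (simp add: Y_def)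
  moreover have "Y \<noteq> 0" using XY[OF \<open>C \<in> A\<close>] \<open>0 < X\<close> by auto
  ultimately have "0 < Y" by simp
  have "X / Y \<le> Inf A"
    using \<open>C \<in> A\<close> XY \<open>0 < Y\<close> by (intro cInf_greatest) (auto simp: divide_le_eq)
  moreover have "sobolev_const TYPE('a) = Inf A"
    by (simp add: sobolev_const_def A_def q_def)
  ultimately show ?thesis
    using \<open>0 < X\<close> \<open>0 < Y\<close> by (metis divide_pos_pos less_le_trans)
qed

section \<open>Admissible masses\<close>

text \<open>The nonlinear term is separated because it scales with the power \<open>p + 1\<close>,
  the gradient term with the power 2.\<close>

definition coupling :: "real \<Rightarrow> real \<Rightarrow> real \<Rightarrow> real \<Rightarrow> 'a::euclidean_space pairH \<Rightarrow> real" where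
  "coupling \<mu>1 \<mu>2 \<beta> p U = (case U of ((u1, g1), (u2, g2)) \<Rightarrow>
     (\<integral>x. \<mu>1 * \<bar>u1 x\<bar> powr (p+1) + 2 * \<beta> * \<bar>u1 x\<bar> powr ((p+1)/2) * \<bar>u2 x\<bar> powr ((p+1)/2)
          + \<mu>2 * \<bar>u2 x\<bar> powr (p+1) \<partial>lborel))"

lemma energy_eq: "energy \<mu>1 \<mu>2 \<beta> p U = grad_sq U / 2 - coupling \<mu>1 \<mu>2 \<beta> p U / (p + 1)"
  by (cases U) (auto simp: energy_def grad_sq_def coupling_def split: prod.splits)

definition pair_scale :: "real \<Rightarrow> 'a::euclidean_space pairH \<Rightarrow> 'a pairH" where
  "pair_scale c U = (case U of ((u1, g1), (u2, g2)) \<Rightarrow>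
     ((\<lambda>x. c * u1 x, \<lambda>x. c *\<^sub>R g1 x), (\<lambda>x. c * u2 x, \<lambda>x. c *\<^sub>R g2 x)))"

lemma pair_scale_inverse: "c \<noteq> 0 \<Longrightarrow> pair_scale c (pair_scale (1 / c) U) = U"
  by (cases U) (auto simp: pair_scale_def split: prod.splits)

lemma mass_set_pair_scale:
  "U \<in> mass_set \<Omega> \<rho>1 \<rho>2 \<Longrightarrow> pair_scale c U \<in> mass_set \<Omega> (c\<^sup>2 * \<rho>1) (c\<^sup>2 * \<rho>2)"
  by (cases U) (auto simp: mass_set_def pair_scale_def power_mult_distrib intro: H10_scale)

lemma grad_sq_pair_scale: "grad_sq (pair_scale c U) = c\<^sup>2 * grad_sq U"
proof -
  obtain u1 g1 u2 g2 where fields: "U = ((u1, g1), (u2, g2))" by (metis surj_pair)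
  then show ?thesis
    by (simp add: grad_sq_def pair_scale_def power_mult_distrib distrib_left[symmetric])
qed

lemma coupling_pair_scale:
  assumes "0 < c"
  shows "coupling \<mu>1 \<mu>2 \<beta> p (pair_scale c U) = c powr (p + 1) * coupling \<mu>1 \<mu>2 \<beta> p U"
proof -
  obtain u1 g1 u2 g2 where fields: "U = ((u1, g1), (u2, g2))" by (metis surj_pair)
  have half: "c powr ((p + 1) / 2) * c powr ((p + 1) / 2) = c powr (p + 1)"
    by (simp add: powr_add[symmetric])
  have hom: "\<bar>c * y\<bar> powr e = c powr e * \<bar>y\<bar> powr e" for y e
    using assms by (simp add: abs_mult powr_mult)
  have "\<mu>1 * \<bar>c * u1 x\<bar> powr (p+1) + 2 * \<beta> * \<bar>c * u1 x\<bar> powr ((p+1)/2) * \<bar>c * u2 x\<bar> powr ((p+1)/2)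
      + \<mu>2 * \<bar>c * u2 x\<bar> powr (p+1)
    = c powr (p + 1) * (\<mu>1 * \<bar>u1 x\<bar> powr (p+1)
      + 2 * \<beta> * \<bar>u1 x\<bar> powr ((p+1)/2) * \<bar>u2 x\<bar> powr ((p+1)/2) + \<mu>2 * \<bar>u2 x\<bar> powr (p+1))" for x
    unfolding hom half[symmetric] by (simp add: algebra_simps)
  then show ?thesis
    unfolding fields by (simp add: coupling_def pair_scale_def)
qed

lemma admissible_scale:
  assumes "(\<rho>1, \<rho>2) \<in> admissible \<Omega> \<mu>1 \<mu>2 \<beta> p" "0 < t" "t \<le> 1" "1 < p"
  shows "(t * \<rho>1, t * \<rho>2) \<in> admissible \<Omega> \<mu>1 \<mu>2 \<beta> p"
proof (cases "(\<rho>1, \<rho>2) = (0, 0)")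
  case True
  then show ?thesis by (simp add: admissible_def)
next
  case False
  let ?E = "energy \<mu>1 \<mu>2 \<beta> p" and ?F = "coupling \<mu>1 \<mu>2 \<beta> p"
  from False assms(1) obtain \<alpha> where \<rho>: "0 \<le> \<rho>1" "0 \<le> \<rho>2" and \<alpha>: "lambda1 \<Omega> \<le> \<alpha>"
    and less: "c_alpha \<Omega> \<mu>1 \<mu>2 \<beta> p \<rho>1 \<rho>2 \<alpha> < c_hat_alpha \<Omega> \<mu>1 \<mu>2 \<beta> p \<rho>1 \<rho>2 \<alpha>"
    and crit: "critical TYPE('a) p \<longrightarrow> (\<rho>1 + \<rho>2) * (\<alpha> - lambda1 \<Omega>)
        \<le> Lambda_const TYPE('a) \<mu>1 \<mu>2 \<beta> powr (- (real DIM('a) - 2) / 2)"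
    unfolding admissible_def by auto
  from less obtain U where U: "U \<in> B_set \<Omega> \<rho>1 \<rho>2 \<alpha>"
    and "ereal (?E U) < c_hat_alpha \<Omega> \<mu>1 \<mu>2 \<beta> p \<rho>1 \<rho>2 \<alpha>"
    unfolding c_alpha_def INF_less_iff by blast
  \<comment> \<open>The infima need not be attained and \<open>c_hat_alpha\<close> may be infinite;
    a real number strictly in between yields one gap for all elements of the sphere.\<close>
  then obtain e where e: "?E U < e" "ereal e < c_hat_alpha \<Omega> \<mu>1 \<mu>2 \<beta> p \<rho>1 \<rho>2 \<alpha>"
    using ereal_dense2 by fastforce
  \<comment> \<open>The factor \<open>c\<close> multiplies masses and gradient terms by
    \<open>t\<close> and the nonlinear term by \<open>t * s\<close>; \<open>\<delta>\<close> is the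
    part of the gap that survives.\<close>
  define c where "c = sqrt t"
  define s where "s = t powr ((p - 1) / 2)"
  define \<delta> where "\<delta> = t * (s * (e - ?E U))"
  have c: "0 < c" "c\<^sup>2 = t" using assms(2) by (auto simp: c_def)
  have s: "0 < s" "s \<le> 1" using assms by (auto simp: s_def powr_le1)
  have "c powr (p + 1) = (t powr (1 / 2)) powr (p + 1)"
    using assms(2) by (simp add: c_def powr_half_sqrt)
  also have "\<dots> = t powr (1 + (p - 1) / 2)"
    by (simp add: powr_powr add_divide_distrib diff_divide_distrib add.commute)
  also have "\<dots> = t * s"
    using assms(2) by (simp add: s_def powr_add)
  finally have cp: "c powr (p + 1) = t * s" .
  have scale: "?E (pair_scale c V) = t * (grad_sq V / 2 - s * (?F V / (p + 1)))" for V :: "'a pairH"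
    unfolding energy_eq grad_sq_pair_scale coupling_pair_scale[OF c(1)] cp c(2) by (simp add: algebra_simps)
  have sU: "pair_scale c U \<in> B_set \<Omega> (t * \<rho>1) (t * \<rho>2) \<alpha>"
    using U mass_set_pair_scale[of U \<Omega> \<rho>1 \<rho>2 c] assms(2)
    by (simp add: B_set_def c grad_sq_pair_scale distrib_left[symmetric] mult.assoc)
  have "?E (pair_scale c U) + \<delta> \<le> ?E V" if V: "V \<in> U_set \<Omega> (t * \<rho>1) (t * \<rho>2) \<alpha>" for V
  proof -
    \<comment> \<open>Scaling is invertible, so every competitor for the smaller masses comes from
      one for the original masses.\<close>
    define W where "W = pair_scale (1 / c) V"
    have V_eq: "V = pair_scale c W" using c by (simp add: W_def pair_scale_inverse)
    have W: "W \<in> U_set \<Omega> \<rho>1 \<rho>2 \<alpha>"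
      using V mass_set_pair_scale[of V \<Omega> "t * \<rho>1" "t * \<rho>2" "1 / c"] assms(2)
      by (simp add: U_set_def W_def grad_sq_pair_scale power_divide c distrib_left[symmetric] mult.assoc)
    then have "ereal e \<le> ereal (?E W)"
      using e(2) unfolding c_hat_alpha_def by (meson INF_lower less_imp_le order_trans)
    then have eW: "e - ?E U \<le> ?E W - ?E U" by simp
    have "0 \<le> grad_sq W - grad_sq U"
      using U W by (simp add: B_set_def U_set_def)
    then have "0 \<le> (1 - s) * ((grad_sq W - grad_sq U) / 2)"
      using s by simp
    moreover have "s * (e - ?E U) \<le> s * (?E W - ?E U)"
      using eW s by (intro mult_left_mono) auto
    ultimately have "s * (e - ?E U) \<le> (1 - s) * ((grad_sq W - grad_sq U) / 2) + s * (?E W - ?E U)"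
      by linarith
    then have "\<delta> \<le> t * ((1 - s) * ((grad_sq W - grad_sq U) / 2) + s * (?E W - ?E U))"
      unfolding \<delta>_def using assms(2) by (intro mult_left_mono) auto
    \<comment> \<open>After division by \<open>t\<close>, the gap is half the gradient difference
      minus \<open>s\<close> times the nonlinear difference; the first is split with weights
      \<open>1 - s\<close> and \<open>s\<close> to recover the old energy gap.\<close>
    also have "\<dots> = ?E V - ?E (pair_scale c U)"
      unfolding V_eq scale unfolding energy_eq by (simp add: algebra_simps diff_divide_distrib)
    finally show ?thesis by simp
  qed
  then have "ereal (?E (pair_scale c U) + \<delta>) \<le> c_hat_alpha \<Omega> \<mu>1 \<mu>2 \<beta> p (t * \<rho>1) (t * \<rho>2) \<alpha>"
    unfolding c_hat_alpha_def by (intro INF_greatest) simp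
  moreover have "c_alpha \<Omega> \<mu>1 \<mu>2 \<beta> p (t * \<rho>1) (t * \<rho>2) \<alpha> \<le> ereal (?E (pair_scale c U))"
    unfolding c_alpha_def using sU by (rule INF_lower)
  moreover have "ereal (?E (pair_scale c U)) < ereal (?E (pair_scale c U) + \<delta>)"
    using assms(2) s e(1) by (simp add: \<delta>_def)
  ultimately have "c_alpha \<Omega> \<mu>1 \<mu>2 \<beta> p (t * \<rho>1) (t * \<rho>2) \<alpha> < c_hat_alpha \<Omega> \<mu>1 \<mu>2 \<beta> p (t * \<rho>1) (t * \<rho>2) \<alpha>"
    by order
  \<comment> \<open>The critical threshold does not depend on the masses, and the left-hand side
    decreases because \<open>lambda1 \<Omega> \<le> \<alpha>\<close>.\<close>
  moreover have "(t * \<rho>1 + t * \<rho>2) * (\<alpha> - lambda1 \<Omega>) \<le> (\<rho>1 + \<rho>2) * (\<alpha> - lambda1 \<Omega>)"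
    using \<rho> \<alpha> assms(2,3) by (intro mult_right_mono add_mono mult_left_le_one_le) auto
  ultimately show ?thesis
    using \<rho> \<alpha> crit assms(2) unfolding admissible_def by fastforce
qed

lemma admissible_star_shaped:
  assumes "\<rho> \<in> admissible \<Omega> \<mu>1 \<mu>2 \<beta> p" "1 < p"
  shows "closed_segment 0 \<rho> \<subseteq> admissible \<Omega> \<mu>1 \<mu>2 \<beta> p"
proof
  fix x assume "x \<in> closed_segment 0 \<rho>"
  then obtain t where t: "0 \<le> t" "t \<le> 1" "x = t *\<^sub>R \<rho>"
    by (auto simp: in_segment)
  obtain \<rho>1 \<rho>2 where \<rho>: "\<rho> = (\<rho>1, \<rho>2)" by (cases \<rho>)
  show "x \<in> admissible \<Omega> \<mu>1 \<mu>2 \<beta> p"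
  proof (cases "t = 0")
    case True
    then show ?thesis using t by (simp add: admissible_def zero_prod_def)
  next
    case False
    then show ?thesis using t admissible_scale[of \<rho>1 \<rho>2 \<Omega> \<mu>1 \<mu>2 \<beta> p t] assms by (simp add: \<rho>)
  qed
qed

section \<open>Estimates for small masses\<close>

text \<open>The Cauchy-Schwarz inequality bounds the mixed term by the geometric mean of the two
  given bounds. The factor 2 is the coefficient of the mixed term and also bounds the sum of the
  pure terms by their maximum.\<close>

lemma coupling_le:
  fixes \<Omega> :: "'a::euclidean_space set"
  assumes "((u1, g1), (u2, g2)) \<in> mass_set \<Omega> \<rho>1 \<rho>2"
    and "0 \<le> \<mu>1" "0 \<le> \<mu>2" "0 \<le> \<rho>1" "0 \<le> \<rho>2" "0 \<le> D" "0 \<le> r" "0 < p + 1"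
    and X1: "(\<integral>\<^sup>+x. ennreal (\<bar>u1 x\<bar> powr (p + 1)) \<partial>lborel) \<le> ennreal (D * pow0 \<rho>1 (2 * r))"
    and X2: "(\<integral>\<^sup>+x. ennreal (\<bar>u2 x\<bar> powr (p + 1)) \<partial>lborel) \<le> ennreal (D * pow0 \<rho>2 (2 * r))"
  shows "coupling \<mu>1 \<mu>2 \<beta> p ((u1, g1), (u2, g2)) \<le>
    2 * D * (max (\<mu>1 * pow0 \<rho>1 (2 * r)) (\<mu>2 * pow0 \<rho>2 (2 * r)) + max \<beta> 0 * pow0 \<rho>1 r * pow0 \<rho>2 r)"
proof -
  have [measurable]: "u1 \<in> borel_measurable borel" "u2 \<in> borel_measurable borel"
    using assms(1) H10_measurable by (auto simp: mass_set_def)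
  define b where "b = max \<beta> 0"
  have b: "0 \<le> b" "\<beta> \<le> b" by (auto simp: b_def)
  have cross: "(\<integral>\<^sup>+x. ennreal (\<bar>u1 x\<bar> powr ((p + 1) / 2) * \<bar>u2 x\<bar> powr ((p + 1) / 2)) \<partial>lborel)
      \<le> ennreal (D * pow0 \<rho>1 r * pow0 \<rho>2 r)"
  proof -
    have half: "ennreal (\<bar>y\<bar> powr ((p + 1) / 2)) = epowr (ennreal (\<bar>y\<bar> powr (p + 1))) (1 / 2)" for y
      using assms(8) by (simp add: epowr_ennreal pow0_def powr_powr)
    have root: "epowr (ennreal (D * pow0 \<rho> (2 * r))) (1 / 2) = epowr (ennreal D) (1 / 2) * ennreal (pow0 \<rho> r)"
      if "0 \<le> \<rho>" for \<rho>
      using assms(6,7) that epowr_epowr[of "2 * r" "1 / 2" "ennreal \<rho>"]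
      by (simp add: ennreal_mult epowr_mult epowr_ennreal)
    have "(\<integral>\<^sup>+x. ennreal (\<bar>u1 x\<bar> powr ((p + 1) / 2) * \<bar>u2 x\<bar> powr ((p + 1) / 2)) \<partial>lborel)
        = (\<integral>\<^sup>+x. epowr (ennreal (\<bar>u1 x\<bar> powr (p + 1))) (1 / 2) * epowr (ennreal (\<bar>u2 x\<bar> powr (p + 1))) (1 / 2) \<partial>lborel)"
      by (simp add: ennreal_mult half)
    also have "\<dots> \<le> epowr (\<integral>\<^sup>+x. ennreal (\<bar>u1 x\<bar> powr (p + 1)) \<partial>lborel) (1 / 2)
        * epowr (\<integral>\<^sup>+x. ennreal (\<bar>u2 x\<bar> powr (p + 1)) \<partial>lborel) (1 / 2)"
      by (intro Hoelder2_nn_integral) auto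
    also have "\<dots> \<le> epowr (ennreal (D * pow0 \<rho>1 (2 * r))) (1 / 2) * epowr (ennreal (D * pow0 \<rho>2 (2 * r))) (1 / 2)"
      using X1 X2 by (intro mult_mono epowr_mono) auto
    also have "\<dots> = (epowr (ennreal D) (1 / 2) * epowr (ennreal D) (1 / 2)) * ennreal (pow0 \<rho>1 r) * ennreal (pow0 \<rho>2 r)"
      using assms(4,5) by (simp only: root) (simp only: ac_simps)
    also have "epowr (ennreal D) (1 / 2) * epowr (ennreal D) (1 / 2) = ennreal D"
      by (subst epowr_add[symmetric]) auto
    also have "ennreal D * ennreal (pow0 \<rho>1 r) * ennreal (pow0 \<rho>2 r) = ennreal (D * pow0 \<rho>1 r * pow0 \<rho>2 r)"
      using assms(6) by (simp add: ennreal_mult)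
    finally show ?thesis .
  qed
  define Z where "Z = \<mu>1 * (D * pow0 \<rho>1 (2 * r)) + 2 * b * (D * pow0 \<rho>1 r * pow0 \<rho>2 r) + \<mu>2 * (D * pow0 \<rho>2 (2 * r))"
  have Z0: "0 \<le> Z" using assms b by (auto simp: Z_def)
  have "coupling \<mu>1 \<mu>2 \<beta> p ((u1, g1), (u2, g2)) \<le> Z"
    unfolding coupling_def prod.case
  \<comment> \<open>Under \<open>ennreal\<close> the negative values that the integrand may take for
    \<beta> < 0 become 0, so an estimate of the nonnegative integral is enough.\<close>
  proof (rule integral_real_bounded[OF Z0])
    have "(\<integral>\<^sup>+x. ennreal (\<mu>1 * \<bar>u1 x\<bar> powr (p+1) + 2 * \<beta> * \<bar>u1 x\<bar> powr ((p+1)/2) * \<bar>u2 x\<bar> powr ((p+1)/2)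
          + \<mu>2 * \<bar>u2 x\<bar> powr (p+1)) \<partial>lborel)
      \<le> (\<integral>\<^sup>+x. ennreal \<mu>1 * ennreal (\<bar>u1 x\<bar> powr (p+1))
          + ennreal (2 * b) * ennreal (\<bar>u1 x\<bar> powr ((p+1)/2) * \<bar>u2 x\<bar> powr ((p+1)/2))
          + ennreal \<mu>2 * ennreal (\<bar>u2 x\<bar> powr (p+1)) \<partial>lborel)"
    proof (intro nn_integral_mono)
      fix x
      have "2 * \<beta> * (\<bar>u1 x\<bar> powr ((p+1)/2) * \<bar>u2 x\<bar> powr ((p+1)/2))
          \<le> 2 * b * (\<bar>u1 x\<bar> powr ((p+1)/2) * \<bar>u2 x\<bar> powr ((p+1)/2))"
        using b by (intro mult_right_mono) auto
      then have "ennreal (\<mu>1 * \<bar>u1 x\<bar> powr (p+1) + 2 * \<beta> * \<bar>u1 x\<bar> powr ((p+1)/2) * \<bar>u2 x\<bar> powr ((p+1)/2)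
          + \<mu>2 * \<bar>u2 x\<bar> powr (p+1)) \<le> ennreal (\<mu>1 * \<bar>u1 x\<bar> powr (p+1)
          + 2 * b * (\<bar>u1 x\<bar> powr ((p+1)/2) * \<bar>u2 x\<bar> powr ((p+1)/2)) + \<mu>2 * \<bar>u2 x\<bar> powr (p+1))"
        by (intro ennreal_leI) (simp add: mult.assoc)
      also have "\<dots> = ennreal \<mu>1 * ennreal (\<bar>u1 x\<bar> powr (p+1))
          + ennreal (2 * b) * ennreal (\<bar>u1 x\<bar> powr ((p+1)/2) * \<bar>u2 x\<bar> powr ((p+1)/2))
          + ennreal \<mu>2 * ennreal (\<bar>u2 x\<bar> powr (p+1))"
        using assms(2,3) b by (simp only: ennreal_plus ennreal_mult[symmetric] mult_nonneg_nonneg add_nonneg_nonneg powr_ge_zero zero_le_numeral)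
      finally show "ennreal (\<mu>1 * \<bar>u1 x\<bar> powr (p+1) + 2 * \<beta> * \<bar>u1 x\<bar> powr ((p+1)/2) * \<bar>u2 x\<bar> powr ((p+1)/2)
          + \<mu>2 * \<bar>u2 x\<bar> powr (p+1)) \<le> \<dots>" .
    qed
    also have "\<dots> = ennreal \<mu>1 * (\<integral>\<^sup>+x. ennreal (\<bar>u1 x\<bar> powr (p+1)) \<partial>lborel)
          + ennreal (2 * b) * (\<integral>\<^sup>+x. ennreal (\<bar>u1 x\<bar> powr ((p+1)/2) * \<bar>u2 x\<bar> powr ((p+1)/2)) \<partial>lborel)
          + ennreal \<mu>2 * (\<integral>\<^sup>+x. ennreal (\<bar>u2 x\<bar> powr (p+1)) \<partial>lborel)"
      by (simp add: nn_integral_add nn_integral_cmult)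
    also have "\<dots> \<le> ennreal \<mu>1 * ennreal (D * pow0 \<rho>1 (2 * r)) + ennreal (2 * b) * ennreal (D * pow0 \<rho>1 r * pow0 \<rho>2 r)
        + ennreal \<mu>2 * ennreal (D * pow0 \<rho>2 (2 * r))"
      using X1 X2 cross by (intro add_mono mult_left_mono) auto
    also have "\<dots> = ennreal Z"
      unfolding Z_def using assms b by (simp only: ennreal_plus ennreal_mult[symmetric] mult_nonneg_nonneg
          add_nonneg_nonneg pow0_nonneg zero_le_numeral)
    finally show "(\<integral>\<^sup>+x. ennreal (\<mu>1 * \<bar>u1 x\<bar> powr (p+1) + 2 * \<beta> * \<bar>u1 x\<bar> powr ((p+1)/2) * \<bar>u2 x\<bar> powr ((p+1)/2)
          + \<mu>2 * \<bar>u2 x\<bar> powr (p+1)) \<partial>lborel) \<le> ennreal Z" .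
  qed
  also have "Z = D * (\<mu>1 * pow0 \<rho>1 (2 * r) + \<mu>2 * pow0 \<rho>2 (2 * r) + 2 * (b * pow0 \<rho>1 r * pow0 \<rho>2 r))"
    by (simp add: Z_def algebra_simps)
  also have "\<dots> \<le> D * (2 * (max (\<mu>1 * pow0 \<rho>1 (2 * r)) (\<mu>2 * pow0 \<rho>2 (2 * r)) + b * pow0 \<rho>1 r * pow0 \<rho>2 r))"
    using assms(6) by (intro mult_left_mono) auto
  finally show ?thesis by (simp add: b_def algebra_simps)
qed

text \<open>On the unit circle all powers are at most 1, and the point (1, 0) gives the value
  \<open>\<mu>1\<close>. The upper bound has the form that the small-mass condition takes in the
  critical case, where \<open>exp_r\<close> is 0.\<close>

lemma Lambda_const_bounds:
  assumes "3 \<le> DIM('a::euclidean_space)" "0 < \<mu>1" "0 < \<mu>2"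
  shows "0 < Lambda_const TYPE('a) \<mu>1 \<mu>2 \<beta>"
    and "Lambda_const TYPE('a) \<mu>1 \<mu>2 \<beta>
      \<le> 4 * sobolev_const TYPE('a) / two_star DIM('a) * (max \<mu>1 \<mu>2 + max \<beta> 0)"
proof -
  define q where "q = two_star DIM('a)"
  define S where "S = sobolev_const TYPE('a)"
  define b where "b = max \<beta> 0"
  define f where "f = (\<lambda>(x::real, y::real). \<mu>1 * \<bar>x\<bar> powr q + \<mu>2 * \<bar>y\<bar> powr q + 2 * b * \<bar>x * y\<bar> powr (q / 2))"
  define A where "A = f ` {(x, y). x\<^sup>2 + y\<^sup>2 = 1}"
  have q: "0 < q" using assms(1) by (simp add: q_def two_star_def)
  have S: "0 < S" using sobolev_const_pos[OF assms(1)] by (simp add: S_def)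
  have b: "0 \<le> b" by (simp add: b_def)
  have bound: "z \<le> 2 * (max \<mu>1 \<mu>2 + b)" if "z \<in> A" for z
  proof -
    obtain x y where xy: "x\<^sup>2 + y\<^sup>2 = 1" "z = f (x, y)"
      using \<open>z \<in> A\<close> by (auto simp: A_def)
    have "\<bar>x\<bar> \<le> 1" "\<bar>y\<bar> \<le> 1"
      unfolding abs_le_square_iff[of _ 1, simplified]
      using xy(1) zero_le_power2[of x] zero_le_power2[of y] by linarith+
    then have "\<bar>x\<bar> powr q \<le> 1" "\<bar>y\<bar> powr q \<le> 1" "\<bar>x * y\<bar> powr (q / 2) \<le> 1"
      using q by (auto intro!: powr_le1 simp: abs_mult mult_le_one)
    then have "\<mu>1 * \<bar>x\<bar> powr q \<le> \<mu>1" "\<mu>2 * \<bar>y\<bar> powr q \<le> \<mu>2" "2 * b * \<bar>x * y\<bar> powr (q / 2) \<le> 2 * b"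
      using assms b by (auto intro: mult_left_le)
    then show ?thesis unfolding xy(2) f_def by auto
  qed
  have "f (1, 0) \<in> A" by (auto simp: A_def)
  then have "\<mu>1 \<in> A" using q by (simp add: f_def)
  have "0 < \<mu>1" by fact
  also have "\<mu>1 \<le> Sup A"
    using \<open>\<mu>1 \<in> A\<close> bound by (intro cSup_upper bdd_aboveI) auto
  finally have pos: "0 < Sup A" .
  have le: "Sup A \<le> 2 * (max \<mu>1 \<mu>2 + b)"
    using \<open>\<mu>1 \<in> A\<close> bound by (intro cSup_least) auto
  have eq: "Lambda_const TYPE('a) \<mu>1 \<mu>2 \<beta> = 2 * S / q * Sup A"
    by (simp add: Lambda_const_def S_def q_def A_def f_def b_def)
  show "0 < Lambda_const TYPE('a) \<mu>1 \<mu>2 \<beta>"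
    unfolding eq using S q pos by simp
  have "2 * S / q * Sup A \<le> 2 * S / q * (2 * (max \<mu>1 \<mu>2 + b))"
    using S q le by (intro mult_left_mono) auto
  also have "\<dots> = 4 * S / q * (max \<mu>1 \<mu>2 + b)"
    by (simp add: field_simps)
  finally show "Lambda_const TYPE('a) \<mu>1 \<mu>2 \<beta>
      \<le> 4 * sobolev_const TYPE('a) / two_star DIM('a) * (max \<mu>1 \<mu>2 + max \<beta> 0)"
    unfolding eq unfolding S_def q_def b_def .
qed

text \<open>Inside a closed ball of radius \<open>e\<close> in \<Omega>, two balls of radius
  \<open>e / 8\<close> with centres \<open>e / 2\<close> apart are disjoint and stay in
  \<Omega>.\<close>

lemma C1c_disjoint_normalized_exist:
  fixes \<Omega> :: "'a::euclidean_space set"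
  assumes "open \<Omega>" "\<Omega> \<noteq> {}"
  obtains u1 du1 u2 du2 where "C1c \<Omega> u1 du1" "C1c \<Omega> u2 du2"
    "(\<integral>x. (u1 x)\<^sup>2 \<partial>lborel) = 1" "(\<integral>x. (u2 x)\<^sup>2 \<partial>lborel) = 1" "\<And>x. u1 x = 0 \<or> u2 x = 0"
proof -
  obtain c e where c: "0 < e" "cball c e \<subseteq> \<Omega>"
    using assms open_contains_cball by (metis all_not_in_conv)
  obtain i :: 'a where i: "i \<in> Basis" using nonempty_Basis by blast
  define d where "d = c + (e / 2) *\<^sub>R i"
  have dist: "dist c d = e / 2" using c i by (simp add: d_def dist_norm)
  obtain u1 du1 where u1: "C1c (cball c (e / 8)) u1 du1" "(\<integral>x. (u1 x)\<^sup>2 \<partial>lborel) = 1"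
    using C1c_normalized_exists[of "e / 8" c] c by auto
  obtain u2 du2 where u2: "C1c (cball d (e / 8)) u2 du2" "(\<integral>x. (u2 x)\<^sup>2 \<partial>lborel) = 1"
    using C1c_normalized_exists[of "e / 8" d] c by auto
  have sub: "cball c (e / 8) \<subseteq> \<Omega>" "cball d (e / 8) \<subseteq> \<Omega>"
  proof -
    have "cball c (e / 8) \<subseteq> cball c e" using c by (intro subset_cball) auto
    then show "cball c (e / 8) \<subseteq> \<Omega>" using c by blast
    have "x \<in> cball c e" if "x \<in> cball d (e / 8)" for x
      using that dist_triangle[of c x d] dist c by (simp add: dist_commute)
    then show "cball d (e / 8) \<subseteq> \<Omega>" using c by blast
  qed
  have "u1 x = 0 \<or> u2 x = 0" for x
  proof -
    have "x \<notin> cball c (e / 8) \<or> x \<notin> cball d (e / 8)"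
      using dist_triangle[of c d x] dist c by (auto simp: dist_commute)
    moreover have "x \<notin> cball c (e / 8) \<Longrightarrow> u1 x = 0" "x \<notin> cball d (e / 8) \<Longrightarrow> u2 x = 0"
      using u1(1) u2(1) unfolding C1c_def by blast+
    ultimately show ?thesis by blast
  qed
  then show thesis
    using that[OF C1c_mono[OF u1(1) sub(1)] C1c_mono[OF u2(1) sub(2)] u1(2) u2(2)] by blast
qed

text \<open>For unit mass the gradient integral is itself a Rayleigh quotient, so the infimum is
  over a nonempty set of nonnegative numbers.\<close>

lemma lambda1_bounds:
  assumes "(u, g) \<in> H10 \<Omega>" "(\<integral>x. (u x)\<^sup>2 \<partial>lborel) = 1"
  shows "0 \<le> lambda1 \<Omega>" "lambda1 \<Omega> \<le> (\<integral>x. (norm (g x))\<^sup>2 \<partial>lborel)"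
proof -
  define A where "A = {(\<integral>x. (norm (g x))\<^sup>2 \<partial>lborel) / (\<integral>x. (u x)\<^sup>2 \<partial>lborel) | u g.
      (u, g) \<in> H10 \<Omega> \<and> (\<integral>x. (u x)\<^sup>2 \<partial>lborel) \<noteq> 0}"
  have mem: "(\<integral>x. (norm (g x))\<^sup>2 \<partial>lborel) \<in> A"
    using assms unfolding A_def by force
  have nonneg: "0 \<le> y" if "y \<in> A" for y
    using that by (auto simp: A_def)
  have eq: "lambda1 \<Omega> = Inf A" by (simp add: lambda1_def A_def)
  show "0 \<le> lambda1 \<Omega>"
    unfolding eq using mem nonneg by (intro cInf_greatest) auto
  show "lambda1 \<Omega> \<le> (\<integral>x. (norm (g x))\<^sup>2 \<partial>lborel)"
    unfolding eq using mem nonneg by (intro cInf_lower bdd_belowI) auto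
qed

text \<open>Raised to the power \<open>2 / (n - 2)\<close>, the claim says that the product of this
  power of \<open>\<rho> * \<alpha>\<close> with \<open>\<Lambda>\<close> is at most 1; the bound on
  \<open>\<Lambda>\<close> and the smallness condition multiply to exactly this.\<close>

lemma critical_threshold:
  fixes S \<Lambda> M \<rho> \<alpha> q n :: real
  assumes "3 \<le> n" "q = 2 * n / (n - 2)" "0 < S" "0 < \<Lambda>" "\<Lambda> \<le> 4 * S / q * M"
    and "0 < \<rho>" "0 < \<alpha>" "M * \<rho> powr (2 / (n - 2)) \<le> q / (4 * S * \<alpha> powr (2 / (n - 2)))"
  shows "\<rho> * \<alpha> \<le> \<Lambda> powr (- (n - 2) / 2)"
proof -
  define k where "k = 2 / (n - 2)"
  have k: "0 < k" using assms(1) by (simp add: k_def)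
  have q: "0 < q" using assms(1,2) by simp
  have "(\<rho> * \<alpha>) powr k * \<Lambda> \<le> (\<rho> * \<alpha>) powr k * (4 * S / q * M)"
    using assms(5) by (intro mult_left_mono) auto
  also have "\<dots> = 4 * S * \<alpha> powr k / q * (M * \<rho> powr k)"
    using assms(6,7) by (simp add: powr_mult)
  also have "\<dots> \<le> 4 * S * \<alpha> powr k / q * (q / (4 * S * \<alpha> powr k))"
    using assms(3,8) q unfolding k_def[symmetric] by (intro mult_left_mono) auto
  also have "\<dots> = 1"
    using assms(3,7) q by simp
  finally have "(\<rho> * \<alpha>) powr k \<le> \<Lambda> powr (- 1)"
    using assms(4) by (simp add: powr_minus field_simps)
  then have "((\<rho> * \<alpha>) powr k) powr (1 / k) \<le> (\<Lambda> powr (- 1)) powr (1 / k)"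
    using k by (intro powr_mono2) auto
  moreover have "(\<Lambda> powr (- 1)) powr (1 / k) = \<Lambda> powr (- (1 / k))"
    by (subst powr_powr) simp
  ultimately have "\<rho> * \<alpha> \<le> \<Lambda> powr (- (1 / k))"
    using k assms(6,7) by (simp add: powr_powr)
  also have "- (1 / k) = - (n - 2) / 2" by (simp add: k_def minus_divide_left)
  finally show ?thesis .
qed

lemma admissible_small_mass:
  fixes \<Omega> :: "'a::euclidean_space set"
  assumes "open \<Omega>" "\<Omega> \<noteq> {}" and p: "1 + 4 / real DIM('a) < p"
    and p_upper: "DIM('a) \<ge> 3 \<Longrightarrow> p \<le> (real DIM('a) + 2) / (real DIM('a) - 2)"
  obtains R where "0 < R" "\<And>\<mu>1 \<mu>2 \<beta> \<rho>1 \<rho>2. 0 < \<mu>1 \<Longrightarrow> 0 < \<mu>2 \<Longrightarrow> 0 \<le> \<rho>1 \<Longrightarrow> 0 \<le> \<rho>2 \<Longrightarrow>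
    (max (\<mu>1 * pow0 \<rho>1 (2 * exp_r DIM('a) p)) (\<mu>2 * pow0 \<rho>2 (2 * exp_r DIM('a) p))
       + max \<beta> 0 * pow0 \<rho>1 (exp_r DIM('a) p) * pow0 \<rho>2 (exp_r DIM('a) p))
      * (\<rho>1 + \<rho>2) powr (exp_a DIM('a) p - 1) \<le> R \<Longrightarrow>
    (\<rho>1, \<rho>2) \<in> admissible \<Omega> \<mu>1 \<mu>2 \<beta> p"
proof -
  define n where "n = real DIM('a)"
  define a where "a = exp_a DIM('a) p"
  define r where "r = exp_r DIM('a) p"
  have n: "1 \<le> n" by (simp add: n_def Suc_leI)
  have "0 < 4 / n" using n by simp
  then have p1: "1 < p" using p unfolding n_def[symmetric] by linarith
  \<comment> \<open>With \<open>q = p + 1\<close> the Gagliardo-Nirenberg exponents of the gradient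
    integral and the mass are \<open>a\<close> and \<open>2 * r\<close>.\<close>
  have a_eq: "n * (p + 1 - 2) / 4 = a"
    by (simp add: a_def exp_a_def n_def)
  have r_eq: "(p + 1) / 2 - n * (p + 1 - 2) / 4 = 2 * r"
    by (simp add: r_def exp_r_def n_def field_simps)
  have upper: "p + 1 \<le> 2 * n / (n - 2)" if "3 \<le> n"
    using p_upper that by (simp add: n_def field_simps)
  have r0: "0 \<le> r"
  proof (cases "3 \<le> n")
    case True
    then have "(p + 1) * (n - 2) \<le> 2 * n" using upper by (simp add: field_simps)
    then show ?thesis using r_eq by (simp add: field_simps)
  next
    case False
    then have "n \<le> 2" by (simp add: n_def)
    then have "n * (p - 1) \<le> 2 * (p - 1)" using p1 by (intro mult_right_mono) auto
    then show ?thesis using r_eq p1 by (simp add: field_simps)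
  qed
  obtain C where C: "0 < C" "\<And>u g m K. (u, g) \<in> H10 \<Omega> \<Longrightarrow> 0 < K \<Longrightarrow>
    (\<integral>x. (u x)\<^sup>2 \<partial>lborel) = m \<Longrightarrow> (\<integral>x. (norm (g x))\<^sup>2 \<partial>lborel) \<le> K \<Longrightarrow>
    (\<integral>\<^sup>+x. ennreal (\<bar>u x\<bar> powr (p + 1)) \<partial>lborel) \<le> ennreal (C * pow0 m (2 * r) * K powr a)"
    by (rule Gagliardo_Nirenberg_H10[of "p + 1" \<Omega>, folded n_def, unfolded r_eq, unfolded a_eq])
      (use p upper that in \<open>auto simp: n_def\<close>)
  obtain v1 dv1 v2 dv2 where v: "C1c \<Omega> v1 dv1" "C1c \<Omega> v2 dv2"
    "(\<integral>x. (v1 x)\<^sup>2 \<partial>lborel) = 1" "(\<integral>x. (v2 x)\<^sup>2 \<partial>lborel) = 1" "\<And>x. v1 x = 0 \<or> v2 x = 0"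
    using C1c_disjoint_normalized_exist[OF assms(1,2)] by metis
  note vH = C1c_in_H10[OF v(1)] C1c_in_H10[OF v(2)]
  define \<kappa> where "\<kappa> = max (\<integral>x. (norm (dv1 x))\<^sup>2 \<partial>lborel) (\<integral>x. (norm (dv2 x))\<^sup>2 \<partial>lborel)"
  \<comment> \<open>The 2 leaves room for two losses: with \<open>s\<close> the total mass, the
    sphere has energy at least \<open>s * \<alpha> / 2 - s / 2 = s * (\<kappa> + 1) / 2\<close>,
    still above the \<open>s * \<kappa> / 2\<close> reached by the bumps.\<close>
  define \<alpha> where "\<alpha> = \<kappa> + 2"
  have \<kappa>: "lambda1 \<Omega> \<le> \<kappa>" "0 \<le> lambda1 \<Omega>"
    using lambda1_bounds[OF vH(1) v(3)] by (auto simp: \<kappa>_def)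
  then have \<alpha>: "0 < \<alpha>" "lambda1 \<Omega> \<le> \<alpha>" by (auto simp: \<alpha>_def)
  \<comment> \<open>The default 1 keeps \<open>S\<close> and \<open>q\<close> positive in dimensions
    one and two, where there is no critical exponent.\<close>
  define S where "S = (if 3 \<le> DIM('a) then sobolev_const TYPE('a) else 1)"
  define q where "q = (if 3 \<le> DIM('a) then two_star DIM('a) else 1)"
  have S: "0 < S" using sobolev_const_pos[where 'a = 'a] by (simp add: S_def)
  have q: "0 < q" by (simp add: q_def two_star_def)
  \<comment> \<open>The first entry makes the nonlinear part of the energy on the sphere at most
    half the total mass; the second yields the critical threshold. Neither depends on the
    coefficients or the masses.\<close>
  define R where "R = min ((p + 1) / (4 * C * \<alpha> powr a)) (q / (4 * S * \<alpha> powr (a - 1)))"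
  have "0 < R" using p1 C(1) \<alpha>(1) S q by (simp add: R_def)
  moreover have "(\<rho>1, \<rho>2) \<in> admissible \<Omega> \<mu>1 \<mu>2 \<beta> p"
    if \<mu>: "0 < \<mu>1" "0 < \<mu>2" and \<rho>: "0 \<le> \<rho>1" "0 \<le> \<rho>2"
      and small: "(max (\<mu>1 * pow0 \<rho>1 (2 * r)) (\<mu>2 * pow0 \<rho>2 (2 * r)) + max \<beta> 0 * pow0 \<rho>1 r * pow0 \<rho>2 r)
        * (\<rho>1 + \<rho>2) powr (a - 1) \<le> R" for \<mu>1 \<mu>2 \<beta> \<rho>1 \<rho>2
  proof (cases "\<rho>1 + \<rho>2 = 0")
    case True
    then have "\<rho>1 = 0" "\<rho>2 = 0" using \<rho> by auto
    then show ?thesis by (simp add: admissible_def)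
  next
    case False
    define s where "s = \<rho>1 + \<rho>2"
    define M where "M = max (\<mu>1 * pow0 \<rho>1 (2 * r)) (\<mu>2 * pow0 \<rho>2 (2 * r)) + max \<beta> 0 * pow0 \<rho>1 r * pow0 \<rho>2 r"
    have s: "0 < s" using False \<rho> by (simp add: s_def)
    have MR: "M * s powr (a - 1) \<le> R" using small by (simp add: M_def s_def)
    let ?E = "energy \<mu>1 \<mu>2 \<beta> p"
    define W where "W = ((\<lambda>x. sqrt \<rho>1 * v1 x, \<lambda>x. sqrt \<rho>1 *\<^sub>R dv1 x), (\<lambda>x. sqrt \<rho>2 * v2 x, \<lambda>x. sqrt \<rho>2 *\<^sub>R dv2 x))"
    have "W \<in> mass_set \<Omega> \<rho>1 \<rho>2"
      using \<rho> v vH by (auto simp: W_def mass_set_def power_mult_distrib intro!: H10_scale)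
    have "grad_sq W = \<rho>1 * (\<integral>x. (norm (dv1 x))\<^sup>2 \<partial>lborel) + \<rho>2 * (\<integral>x. (norm (dv2 x))\<^sup>2 \<partial>lborel)"
      using \<rho> H10_square_integrable(2)[OF vH(1)] H10_square_integrable(2)[OF vH(2)]
      by (simp add: grad_sq_def W_def power_mult_distrib)
    also have "\<dots> \<le> \<rho>1 * \<kappa> + \<rho>2 * \<kappa>"
      using \<rho> by (intro add_mono mult_left_mono) (auto simp: \<kappa>_def)
    finally have gW: "grad_sq W \<le> s * \<kappa>" by (simp add: s_def algebra_simps)
    also have "\<dots> \<le> s * \<alpha>" using s by (simp add: \<alpha>_def)
    finally have WB: "W \<in> B_set \<Omega> \<rho>1 \<rho>2 \<alpha>"
      using \<open>W \<in> mass_set \<Omega> \<rho>1 \<rho>2\<close> by (simp add: B_set_def s_def)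
    \<comment> \<open>At each point one of the two bumps vanishes, hence so does the mixed term,
      whatever the sign of \<beta>.\<close>
    have "0 \<le> \<mu>1 * \<bar>sqrt \<rho>1 * v1 x\<bar> powr (p+1) + 2 * \<beta> * \<bar>sqrt \<rho>1 * v1 x\<bar> powr ((p+1)/2)
        * \<bar>sqrt \<rho>2 * v2 x\<bar> powr ((p+1)/2) + \<mu>2 * \<bar>sqrt \<rho>2 * v2 x\<bar> powr (p+1)" for x
      using v(5)[of x] \<mu> by auto
    then have "0 \<le> coupling \<mu>1 \<mu>2 \<beta> p W"
      by (simp add: coupling_def W_def)
    then have EW: "?E W \<le> s * \<kappa> / 2"
      using gW p1 unfolding energy_eq by (smt (verit) divide_nonneg_pos divide_right_mono)
    have "s * (\<kappa> + 1) / 2 \<le> ?E V" if V: "V \<in> U_set \<Omega> \<rho>1 \<rho>2 \<alpha>" for V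
    proof -
      obtain u1 g1 u2 g2 where V_eq: "V = ((u1, g1), (u2, g2))" by (metis surj_pair)
      have VM: "((u1, g1), (u2, g2)) \<in> mass_set \<Omega> \<rho>1 \<rho>2" and gV: "grad_sq V = s * \<alpha>"
        using V by (auto simp: U_set_def s_def V_eq)
      then have H: "(u1, g1) \<in> H10 \<Omega>" "(u2, g2) \<in> H10 \<Omega>"
        "(\<integral>x. (u1 x)\<^sup>2 \<partial>lborel) = \<rho>1" "(\<integral>x. (u2 x)\<^sup>2 \<partial>lborel) = \<rho>2"
        by (auto simp: mass_set_def)
      have "(\<integral>x. (norm (g1 x))\<^sup>2 \<partial>lborel) + (\<integral>x. (norm (g2 x))\<^sup>2 \<partial>lborel) = s * \<alpha>"
        using gV H10_square_integrable(2)[OF H(1)] H10_square_integrable(2)[OF H(2)]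
        by (simp add: grad_sq_def V_eq)
      moreover have "0 \<le> (\<integral>x. (norm (g1 x))\<^sup>2 \<partial>lborel)" "0 \<le> (\<integral>x. (norm (g2 x))\<^sup>2 \<partial>lborel)"
        by auto
      ultimately have G: "(\<integral>x. (norm (g1 x))\<^sup>2 \<partial>lborel) \<le> s * \<alpha>" "(\<integral>x. (norm (g2 x))\<^sup>2 \<partial>lborel) \<le> s * \<alpha>"
        by linarith+
      have K: "0 < s * \<alpha>" using s \<alpha> by simp
      have "coupling \<mu>1 \<mu>2 \<beta> p V \<le> 2 * (C * (s * \<alpha>) powr a) * M"
        unfolding V_eq M_def using \<mu> \<rho> C(1) r0 p1 C(2)[OF H(1) K H(3) G(1)] C(2)[OF H(2) K H(4) G(2)]
        by (intro coupling_le[OF VM]) (auto simp: ac_simps)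
      \<comment> \<open>One power of \<open>s\<close> is split off, so that the remaining
        \<open>s powr (a - 1)\<close> combines with \<open>M\<close> to the quantity bounded by
        \<open>R\<close>.\<close>
      also have "(s * \<alpha>) powr a = s * s powr (a - 1) * \<alpha> powr a"
        using s \<alpha> powr_add[of s 1 "a - 1"] by (simp add: powr_mult)
      also have "2 * (C * (s * s powr (a - 1) * \<alpha> powr a)) * M = 2 * C * \<alpha> powr a * s * (M * s powr (a - 1))"
        by simp
      also have "\<dots> \<le> 2 * C * \<alpha> powr a * s * ((p + 1) / (4 * C * \<alpha> powr a))"
        using MR C(1) s by (intro mult_left_mono) (auto simp: R_def)
      also have "\<dots> = s * (p + 1) / 2"
        using C(1) \<alpha>(1) by simp
      finally have "coupling \<mu>1 \<mu>2 \<beta> p V / (p + 1) \<le> s / 2"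
        using p1 by (simp add: field_simps)
      then show ?thesis
        unfolding energy_eq gV \<alpha>_def by (simp add: field_simps)
    qed
    then have "ereal (s * (\<kappa> + 1) / 2) \<le> c_hat_alpha \<Omega> \<mu>1 \<mu>2 \<beta> p \<rho>1 \<rho>2 \<alpha>"
      unfolding c_hat_alpha_def by (intro INF_greatest) simp
    moreover have "c_alpha \<Omega> \<mu>1 \<mu>2 \<beta> p \<rho>1 \<rho>2 \<alpha> \<le> ereal (?E W)"
      unfolding c_alpha_def using WB by (rule INF_lower)
    moreover have "ereal (?E W) < ereal (s * (\<kappa> + 1) / 2)"
      using EW s by (simp add: algebra_simps)
    ultimately have less: "c_alpha \<Omega> \<mu>1 \<mu>2 \<beta> p \<rho>1 \<rho>2 \<alpha> < c_hat_alpha \<Omega> \<mu>1 \<mu>2 \<beta> p \<rho>1 \<rho>2 \<alpha>"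
      by order
    have crit: "(\<rho>1 + \<rho>2) * (\<alpha> - lambda1 \<Omega>) \<le> Lambda_const TYPE('a) \<mu>1 \<mu>2 \<beta> powr (- (real DIM('a) - 2) / 2)"
      if "critical TYPE('a) p"
    proof -
      have dim: "3 \<le> DIM('a)" and p_eq: "p = two_star DIM('a) - 1"
        using that by (auto simp: critical_def)
      have n3: "3 \<le> n" using dim by (simp add: n_def)
      have q_eq: "q = 2 * n / (n - 2)" using dim by (simp add: q_def two_star_def n_def)
      have pq: "p = q - 1" using dim p_eq by (simp add: q_def)
      \<comment> \<open>At the critical exponent the masses enter \<open>M\<close> only through
        \<open>pow0\<close> with exponent 0, so \<open>M\<close> depends on the coefficients
        alone.\<close>
      have "r = 0" "a - 1 = 2 / (n - 2)"
        using n3 r_eq a_eq unfolding pq q_eq by (auto simp: field_simps)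
      have M_eq: "M = max \<mu>1 \<mu>2 + max \<beta> 0"
        by (simp add: M_def \<open>r = 0\<close> pow0_def)
      have "s * \<alpha> \<le> Lambda_const TYPE('a) \<mu>1 \<mu>2 \<beta> powr (- (n - 2) / 2)"
      proof (rule critical_threshold[OF n3 q_eq S])
        show "0 < Lambda_const TYPE('a) \<mu>1 \<mu>2 \<beta>"
          using dim \<mu> by (rule Lambda_const_bounds)
        show "Lambda_const TYPE('a) \<mu>1 \<mu>2 \<beta> \<le> 4 * S / q * M"
          using Lambda_const_bounds(2)[OF dim \<mu>, of \<beta>] dim by (simp add: S_def q_def M_eq)
        show "M * s powr (2 / (n - 2)) \<le> q / (4 * S * \<alpha> powr (2 / (n - 2)))"
          using MR unfolding \<open>a - 1 = 2 / (n - 2)\<close> R_def by simp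
      qed (use s \<alpha> in auto)
      \<comment> \<open>Since \<open>lambda1 \<Omega>\<close> is nonnegative, the stronger bound on
        \<open>s * \<alpha>\<close> suffices.\<close>
      moreover have "s * (\<alpha> - lambda1 \<Omega>) \<le> s * \<alpha>"
        using s \<kappa> by simp
      ultimately show ?thesis by (simp add: s_def n_def)
    qed
    show ?thesis
      using \<rho> \<alpha>(2) less crit unfolding admissible_def by blast
  qed
  ultimately show thesis
    using that unfolding a_def r_def by blast
qed

theorem theorem1p5:
  fixes \<Omega> :: "'a::euclidean_space set" and p :: real
  assumes "bounded \<Omega>" and "lipschitz_domain \<Omega>"
    and "1 + 4 / real DIM('a) < p"
    and "DIM('a) \<ge> 3 \<Longrightarrow> p \<le> (real DIM('a) + 2) / (real DIM('a) - 2)"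
  shows "(\<forall>\<mu>1 \<mu>2 \<beta>. \<mu>1 > 0 \<longrightarrow> \<mu>2 > 0 \<longrightarrow>
            (\<forall>\<rho> \<in> admissible \<Omega> \<mu>1 \<mu>2 \<beta> p. closed_segment 0 \<rho> \<subseteq> admissible \<Omega> \<mu>1 \<mu>2 \<beta> p))
       \<and> (\<exists>R > 0. \<forall>\<mu>1 \<mu>2 \<beta> \<rho>1 \<rho>2. \<mu>1 > 0 \<longrightarrow> \<mu>2 > 0 \<longrightarrow> \<rho>1 \<ge> 0 \<longrightarrow> \<rho>2 \<ge> 0 \<longrightarrow>
            (max (\<mu>1 * pow0 \<rho>1 (2 * exp_r DIM('a) p)) (\<mu>2 * pow0 \<rho>2 (2 * exp_r DIM('a) p))
               + max \<beta> 0 * pow0 \<rho>1 (exp_r DIM('a) p) * pow0 \<rho>2 (exp_r DIM('a) p))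
              * (\<rho>1 + \<rho>2) powr (exp_a DIM('a) p - 1) \<le> R
            \<longrightarrow> (\<rho>1, \<rho>2) \<in> admissible \<Omega> \<mu>1 \<mu>2 \<beta> p)"
proof (intro conjI)
  have "0 \<le> 4 / real DIM('a)" by simp
  then have "1 < p" using assms(3) by linarith
  then show "\<forall>\<mu>1 \<mu>2 \<beta>. \<mu>1 > 0 \<longrightarrow> \<mu>2 > 0 \<longrightarrow>
      (\<forall>\<rho> \<in> admissible \<Omega> \<mu>1 \<mu>2 \<beta> p. closed_segment 0 \<rho> \<subseteq> admissible \<Omega> \<mu>1 \<mu>2 \<beta> p)"
    using admissible_star_shaped by blast
next
  have "open \<Omega>" "\<Omega> \<noteq> {}"
    using assms(2) by (auto simp: lipschitz_domain_def)
  from admissible_small_mass[OF this assms(3,4)]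
  show "\<exists>R > 0. \<forall>\<mu>1 \<mu>2 \<beta> \<rho>1 \<rho>2. \<mu>1 > 0 \<longrightarrow> \<mu>2 > 0 \<longrightarrow> \<rho>1 \<ge> 0 \<longrightarrow> \<rho>2 \<ge> 0 \<longrightarrow>
      (max (\<mu>1 * pow0 \<rho>1 (2 * exp_r DIM('a) p)) (\<mu>2 * pow0 \<rho>2 (2 * exp_r DIM('a) p))
         + max \<beta> 0 * pow0 \<rho>1 (exp_r DIM('a) p) * pow0 \<rho>2 (exp_r DIM('a) p))
        * (\<rho>1 + \<rho>2) powr (exp_a DIM('a) p - 1) \<le> R
      \<longrightarrow> (\<rho>1, \<rho>2) \<in> admissible \<Omega> \<mu>1 \<mu>2 \<beta> p"
    by metis
qed

end
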